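(* Let $\sigma^2>0$, $\epsilon>0$, $\delta\in(0,1)$ and fix any MDP $\mathcal{M}\in\mathfrak{M}_{\sigma^2}$. Then any algorithm which is $(\epsilon,\delta)$-PAC on the class $\mathfrak{M}_{\sigma^2}$ must satisfy, for every $h\in[H]$, $s\in\mathcal{S}_h$ and $a\in\mathcal{A}_h(s)$, $$\mathbb{E}_{\mathcal{M}}[n_h^\tau(s,a)]\ \ge\ \underline{c}_h(s,a):=\frac{\sigma^2\log\big(1/(4\delta)\big)}{4\max\big(\overline{\Delta}_h(s,a),\overline{\Delta}^h_{\min},\epsilon\big)^2},$$ where $\overline{\Delta}^h_{\min}:=\min_{(s',a'):\overline{\Delta}_h(s',a')>0}\overline{\Delta}_h(s',a')$ (over $s'\in\mathcal{S}_h$, $a'\in\mathcal{A}_h(s')$) if $|\mathcal{Z}_h^\epsilon|=1$, and $\overline{\Delta}^h_{\min}:=0$ otherwise. Moreover, for the lower bound function $\underline{c}:\mathcal{E}\to[0,\infty)$ just defined, $$\mathbb{E}_{\mathcal{M}}[\tau]\ \ge\ \varphi^\star(\underline{c}).$$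
   Context: Deterministic MDP. $\mathcal{M}=(\mathcal{S},\mathcal{A},\{f_h,\nu_h\}_{h\in[H]},s_1,H)$, $[H]=\{1,\dots,H\}$, where $\mathcal{S},\mathcal{A}$ are finite sets of states and actions, $f_h:\mathcal{S}\times\mathcal{A}\to\mathcal{S}$ is the (deterministic) transition function at stage $h$, $\nu_h(s,a)$ is a probability distribution on $\mathbb{R}$ (reward distribution) with mean $r_h(s,a)$, and $s_1$ is the initial state. At stage $h$ in state $s$ only the actions in a subset $\mathcal{A}_h(s)\subseteq\mathcal{A}$ are available. $\Pi$ is the (non-empty) set of deterministic policies $\pi=(\pi_h)_{h\in[H]}$, $\pi_h:\mathcal{S}\to\mathcal{A}$ with $\pi_h(s)\in\mathcal{A}_h(s)$ for all $h,s$. Playing $\pi$ gives the trajectory $s_1^\pi=s_1$, $a_h^\pi=\pi_h(s_h^\pi)$, $s_{h+1}^\pi=f_h(s_h^\pi,a_h^\pi)$. $\mathcal{S}_h=\{s:\exists\pi\in\Pi,\ s_h^\pi=s\}$ and $\mathcal{E}=\{(s,a,h):h\in[H],s\in\mathcal{S}_h,a\in\mathcal{A}_h(s)\}$. The return of $\pi$ is $V_1^\pi(s_1)=\sum_{h=1}^H r_h(s_h^\pi,a_h^\pi)$ and $V_1^\star(s_1)=\max_{\pi\in\Pi}V_1^\pi(s_1)$. $\Pi_{s,a,h}=\{\pi\in\Pi: s_h^\pi=s,a_h^\pi=a\}$. The deterministic return gap is $\overline{\Delta}_h(s,a)=V_1^\star(s_1)-\max_{\pi\in\Pi_{s,a,h}}V_1^\pi(s_1)$.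 $\Pi^\epsilon=\{\pi\in\Pi:V_1^\pi(s_1)\ge V_1^\star(s_1)-\epsilon\}$ and $\mathcal{Z}_h^\epsilon=\{(s,a):s\in\mathcal{S}_h,a\in\mathcal{A}_h(s),\Pi_{s,a,h}\cap\Pi^\epsilon\neq\emptyset\}$. A minimum over an empty set is $+\infty$ (and then the corresponding lower bound is $0$). $\mathfrak{M}_{\sigma^2}$ is the class of deterministic MDPs with Gaussian rewards $\nu_h(s,a)=\mathcal{N}(r_h(s,a),\sigma^2)$. Learning protocol. Everything except the reward distributions is known to the learner. In each episode $t=1,2,\dots$ the learner selects a policy $\pi^t\in\Pi$ based on past observations, executes it, and observes its trajectory and rewards $y_h^t\sim\nu_h(s_h^{\pi^t},a_h^{\pi^t})$, $h\in[H]$ (independent given the choices). At the end of an episode it may stop (stopping time $\tau$) and return a policy $\widehat\pi$; an algorithm is a triple $((\pi^t)_t,\tau,\widehat\pi)$. It is $(\epsilon,\delta)$-PAC on a set of MDPs $\mathfrak{M}$ if for every $\mathcal{M}\in\mathfrak{M}$ it stops almost surely and $\mathbb{P}_{\mathcal{M}}(V_1^{\widehat\pi}(s_1)\ge V_1^\star(s_1)-\epsilon)\ge1-\delta$. $n_h^t(s,a)=\sum_{l=1}^t\mathbf{1}\{s_h^{\pi^l}=s,a_h^{\pi^l}=a\}$. Minimum flow. A flow is a function $\eta:\mathcal{E}\to[0,\infty)$ with $\sum_{(s',a'):s'\in\mathcal{S}_{h-1},a'\in\mathcal{A}_{h-1}(s'),f_{h-1}(s',a')=s}\eta_{h-1}(s',a')=\sum_{a\in\mathcal{A}_h(s)}\eta_h(s,a)$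 for all $h>1$, $s\in\mathcal{S}_h$. For $\underline c:\mathcal{E}\to[0,\infty)$, $\varphi^\star(\underline{c})$ is the minimum of $\sum_{a\in\mathcal{A}_1(s_1)}\eta_1(s_1,a)$ over flows $\eta$ with $\eta_h(s,a)\ge\underline{c}_h(s,a)$ for all $(s,a,h)\in\mathcal{E}$. *)

theory Defs
  imports "HOL-Probability.Probability"
begin

section \<open>Deterministic MDPs\<close>

text \<open>
  An MDP is a pair of an environment \<open>D\<close> (everything that the learner knows) and a family \<open>\<nu>\<close> of
  reward distributions. States and actions range over finite types, stages over \<open>{1..horizon D}\<close>.
\<close>

record ('s, 'a) environment =
  horizon :: nat
  init_state :: 's
  avail :: "nat \<Rightarrow> 's \<Rightarrow> 'a set"
  trans_fun :: "nat \<Rightarrow> 's \<Rightarrow> 'a \<Rightarrow> 's"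

type_synonym ('s, 'a) rewards = "nat \<Rightarrow> 's \<Rightarrow> 'a \<Rightarrow> real measure"

type_synonym ('s, 'a) policy = "nat \<Rightarrow> 's \<Rightarrow> 'a"

text \<open>Policies are extensional in the stage, so that there are only finitely many of them.\<close>

definition policies :: "('s, 'a) environment \<Rightarrow> ('s, 'a) policy set" where
  "policies D = (\<Pi>\<^sub>E h\<in>{1..horizon D}. {g. \<forall>s. g s \<in> avail D h s})"

definition valid_environment :: "('s, 'a) environment \<Rightarrow> bool" where
  "valid_environment D \<longleftrightarrow> 1 \<le> horizon D \<and> policies D \<noteq> {}"

text \<open>Stages start at 1; the value at stage 0 is a dummy.\<close>

primrec state_at :: "('s, 'a) environment \<Rightarrow> ('s, 'a) policy \<Rightarrow> nat \<Rightarrow> 's" where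
  "state_at D \<pi> 0 = init_state D"
| "state_at D \<pi> (Suc h) =
     (if h = 0 then init_state D
      else trans_fun D h (state_at D \<pi> h) (\<pi> h (state_at D \<pi> h)))"

definition action_at :: "('s, 'a) environment \<Rightarrow> ('s, 'a) policy \<Rightarrow> nat \<Rightarrow> 'a" where
  "action_at D \<pi> h = \<pi> h (state_at D \<pi> h)"

definition reachable :: "('s, 'a) environment \<Rightarrow> nat \<Rightarrow> 's set" where
  "reachable D h = {s. \<exists>\<pi>\<in>policies D. state_at D \<pi> h = s}"

definition mean_reward :: "('s, 'a) rewards \<Rightarrow> nat \<Rightarrow> 's \<Rightarrow> 'a \<Rightarrow> real" where
  "mean_reward \<nu> h s a = (\<integral>x. x \<partial>\<nu> h s a)"

definition policy_return ::
    "('s, 'a) environment \<Rightarrow> ('s, 'a) rewards \<Rightarrow> ('s, 'a) policy \<Rightarrow> real" where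
  "policy_return D \<nu> \<pi> =
     (\<Sum>h = 1..horizon D. mean_reward \<nu> h (state_at D \<pi> h) (action_at D \<pi> h))"

definition optimal_return :: "('s, 'a) environment \<Rightarrow> ('s, 'a) rewards \<Rightarrow> real" where
  "optimal_return D \<nu> = Max (policy_return D \<nu> ` policies D)"

definition policies_through ::
    "('s, 'a) environment \<Rightarrow> nat \<Rightarrow> 's \<Rightarrow> 'a \<Rightarrow> ('s, 'a) policy set" where
  "policies_through D h s a = {\<pi> \<in> policies D. state_at D \<pi> h = s \<and> action_at D \<pi> h = a}"

definition return_gap ::
    "('s, 'a) environment \<Rightarrow> ('s, 'a) rewards \<Rightarrow> nat \<Rightarrow> 's \<Rightarrow> 'a \<Rightarrow> real" where
  "return_gap D \<nu> h s a =
     optimal_return D \<nu> - Max (policy_return D \<nu> ` policies_through D h s a)"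

definition near_optimal_policies ::
    "('s, 'a) environment \<Rightarrow> ('s, 'a) rewards \<Rightarrow> real \<Rightarrow> ('s, 'a) policy set" where
  "near_optimal_policies D \<nu> \<epsilon> =
     {\<pi> \<in> policies D. policy_return D \<nu> \<pi> \<ge> optimal_return D \<nu> - \<epsilon>}"

definition near_optimal_pairs ::
    "('s, 'a) environment \<Rightarrow> ('s, 'a) rewards \<Rightarrow> real \<Rightarrow> nat \<Rightarrow> ('s \<times> 'a) set" where
  "near_optimal_pairs D \<nu> \<epsilon> h =
     {(s, a). s \<in> reachable D h \<and> a \<in> avail D h s \<and>
        policies_through D h s a \<inter> near_optimal_policies D \<nu> \<epsilon> \<noteq> {}}"

definition gaussian_mdps ::
    "real \<Rightarrow> (('s::finite, 'a::finite) environment \<times> ('s, 'a) rewards) set" where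
  "gaussian_mdps \<sigma>2 = {(D, \<nu>). valid_environment D \<and>
     (\<forall>h\<in>{1..horizon D}. \<forall>s a.
        \<nu> h s a = density lborel (normal_density (mean_reward \<nu> h s a) (sqrt \<sigma>2)))}"

section \<open>Learning protocol\<close>

text \<open>
  The sample space consists of the sequences \<open>\<omega>\<close> where \<open>\<omega> 0\<close> is the internal randomness of the
  learner (an arbitrary sequence of reals; a deterministic learner ignores it) and
  \<open>\<omega> t h\<close>, for \<open>t \<ge> 1\<close>, is the reward at stage \<open>h\<close> of episode \<open>t\<close>. The trajectory of
  episode \<open>t\<close> is a function of the known environment and of the policy that was played, so it
  need not be recorded.
\<close>

definition obs_space :: "('s, 'a) environment \<Rightarrow> nat \<Rightarrow> (nat \<Rightarrow> real) measure" where
  "obs_space D t = (if t = 0 then PiM UNIV (\<lambda>_. borel) else PiM {1..horizon D} (\<lambda>_. borel))"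

type_synonym history = "nat \<Rightarrow> nat \<Rightarrow> real"

record ('s, 'a) algorithm =
  seed :: "(nat \<Rightarrow> real) measure"
  select :: "nat \<Rightarrow> history \<Rightarrow> ('s, 'a) policy"
  stop_time :: "history \<Rightarrow> enat"
  recommend :: "history \<Rightarrow> ('s, 'a) policy"

definition info :: "('s, 'a) environment \<Rightarrow> enat \<Rightarrow> history measure" where
  "info D e = vimage_algebra (space (PiM UNIV (obs_space D)))
     (\<lambda>\<omega>. restrict \<omega> {t. enat t \<le> e}) (PiM {t. enat t \<le> e} (obs_space D))"

definition valid_algorithm :: "('s, 'a) environment \<Rightarrow> ('s, 'a) algorithm \<Rightarrow> bool" where
  "valid_algorithm D alg \<longleftrightarrow>
     prob_space (seed alg) \<and> sets (seed alg) = sets (obs_space D 0) \<and>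
     (\<forall>t\<ge>1. select alg t \<in> PiM {0..<t} (obs_space D) \<rightarrow>\<^sub>M count_space (policies D)) \<and>
     stopping_time (info D) (stop_time alg) \<and>
     (\<forall>\<omega>\<in>space (PiM UNIV (obs_space D)). 1 \<le> stop_time alg \<omega>) \<and>
     recommend alg \<in> filtration.pre_sigma (space (PiM UNIV (obs_space D))) (info D) (stop_time alg)
       \<rightarrow>\<^sub>M count_space (policies D)"

definition played :: "('s, 'a) algorithm \<Rightarrow> nat \<Rightarrow> history \<Rightarrow> ('s, 'a) policy" where
  "played alg t \<omega> = select alg t (restrict \<omega> {0..<t})"

text \<open>Conditional law of observation \<open>t\<close> given the previous ones.\<close>

definition obs_kernel ::
    "('s, 'a) environment \<Rightarrow> ('s, 'a) rewards \<Rightarrow> ('s, 'a) algorithm \<Rightarrow>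
     nat \<Rightarrow> history \<Rightarrow> (nat \<Rightarrow> real) measure" where
  "obs_kernel D \<nu> alg t \<omega> =
     (if t = 0 then seed alg
      else PiM {1..horizon D}
        (\<lambda>h. \<nu> h (state_at D (played alg t \<omega>) h) (action_at D (played alg t \<omega>) h)))"

text \<open>Law of the whole interaction: the Ionescu-Tulcea extension of these kernels.\<close>

definition run_measure ::
    "('s, 'a) environment \<Rightarrow> ('s, 'a) rewards \<Rightarrow> ('s, 'a) algorithm \<Rightarrow> history measure" where
  "run_measure D \<nu> alg =
     projective_family.lim UNIV
       (Ionescu_Tulcea.CI (obs_kernel D \<nu> alg) (obs_space D)) (obs_space D)"

definition pac_on ::
    "(('s, 'a) environment \<times> ('s, 'a) rewards) set \<Rightarrow> real \<Rightarrow> real \<Rightarrow>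
     ('s, 'a) environment \<Rightarrow> ('s, 'a) algorithm \<Rightarrow> bool" where
  "pac_on \<MM> \<epsilon> \<delta> D alg \<longleftrightarrow> (\<forall>\<nu>. (D, \<nu>) \<in> \<MM> \<longrightarrow>
     (AE \<omega> in run_measure D \<nu> alg. stop_time alg \<omega> < \<infinity>) \<and>
     \<P>(\<omega> in run_measure D \<nu> alg.
        policy_return D \<nu> (recommend alg \<omega>) \<ge> optimal_return D \<nu> - \<epsilon>) \<ge> 1 - \<delta>)"

definition visits ::
    "('s, 'a) environment \<Rightarrow> ('s, 'a) algorithm \<Rightarrow> nat \<Rightarrow> 's \<Rightarrow> 'a \<Rightarrow> nat \<Rightarrow> history \<Rightarrow> nat" where
  "visits D alg h s a t \<omega> =
     (\<Sum>l = 1..t. if state_at D (played alg l \<omega>) h = s \<and> action_at D (played alg l \<omega>) h = a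
                  then 1 else 0)"

text \<open>\<open>the_enat\<close> is only relevant where the algorithm stops.\<close>

definition expected_visits ::
    "('s, 'a) environment \<Rightarrow> ('s, 'a) rewards \<Rightarrow> ('s, 'a) algorithm \<Rightarrow>
     nat \<Rightarrow> 's \<Rightarrow> 'a \<Rightarrow> ennreal" where
  "expected_visits D \<nu> alg h s a =
     (\<integral>\<^sup>+ \<omega>. of_nat (visits D alg h s a (the_enat (stop_time alg \<omega>)) \<omega>) \<partial>run_measure D \<nu> alg)"

definition expected_stop_time ::
    "('s, 'a) environment \<Rightarrow> ('s, 'a) rewards \<Rightarrow> ('s, 'a) algorithm \<Rightarrow> ennreal" where
  "expected_stop_time D \<nu> alg =
     (\<integral>\<^sup>+ \<omega>. ennreal_of_enat (stop_time alg \<omega>) \<partial>run_measure D \<nu> alg)"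

section \<open>Minimum flow and the lower bound function\<close>

definition is_flow :: "('s, 'a) environment \<Rightarrow> (nat \<Rightarrow> 's \<Rightarrow> 'a \<Rightarrow> real) \<Rightarrow> bool" where
  "is_flow D \<eta> \<longleftrightarrow>
     (\<forall>h\<in>{1..horizon D}. \<forall>s\<in>reachable D h. \<forall>a\<in>avail D h s. 0 \<le> \<eta> h s a) \<and>
     (\<forall>h\<in>{2..horizon D}. \<forall>s\<in>reachable D h.
        (\<Sum>(s', a') | s' \<in> reachable D (h - 1) \<and> a' \<in> avail D (h - 1) s' \<and>
                       trans_fun D (h - 1) s' a' = s. \<eta> (h - 1) s' a')
        = (\<Sum>a\<in>avail D h s. \<eta> h s a))"

definition min_flow :: "('s, 'a) environment \<Rightarrow> (nat \<Rightarrow> 's \<Rightarrow> 'a \<Rightarrow> real) \<Rightarrow> ennreal" where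
  "min_flow D c =
     (INF \<eta>\<in>{\<eta>. is_flow D \<eta> \<and>
        (\<forall>h\<in>{1..horizon D}. \<forall>s\<in>reachable D h. \<forall>a\<in>avail D h s. c h s a \<le> \<eta> h s a)}.
      ennreal (\<Sum>a\<in>avail D 1 (init_state D). \<eta> 1 (init_state D) a))"

text \<open>In \<open>ereal\<close> the infimum of the empty set is \<open>\<infinity>\<close>, and \<open>x / \<infinity> = 0\<close>.\<close>

definition min_return_gap ::
    "('s, 'a) environment \<Rightarrow> ('s, 'a) rewards \<Rightarrow> real \<Rightarrow> nat \<Rightarrow> ereal" where
  "min_return_gap D \<nu> \<epsilon> h =
     (if card (near_optimal_pairs D \<nu> \<epsilon> h) = 1
      then INF (s, a)\<in>{(s, a). s \<in> reachable D h \<and> a \<in> avail D h s \<and> 0 < return_gap D \<nu> h s a}.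
             ereal (return_gap D \<nu> h s a)
      else 0)"

definition visit_bound ::
    "('s, 'a) environment \<Rightarrow> ('s, 'a) rewards \<Rightarrow> real \<Rightarrow> real \<Rightarrow> real \<Rightarrow>
     nat \<Rightarrow> 's \<Rightarrow> 'a \<Rightarrow> real" where
  "visit_bound D \<nu> \<sigma>2 \<epsilon> \<delta> h s a =
     real_of_ereal (ereal (\<sigma>2 * ln (1 / (4 * \<delta>))) /
       (4 * (Max {ereal (return_gap D \<nu> h s a), min_return_gap D \<nu> \<epsilon> h, ereal \<epsilon>})\<^sup>2))"

end

theory Submission
  imports Defs
begin

text \<open>
  Shift the mean reward of a single triple \<open>(h, s, a)\<close> by \<open>d\<close>. The two laws of the interaction differ
  only through the rewards of the episodes that visit the triple, and the log-likelihood ratio up to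
  the stopping time has mean \<open>- d\<^sup>2 / (2 \<sigma>\<^sup>2)\<close> times the expected number of visits under the original
  law. If some set of recommendations has probability at least \<open>1 / 2\<close> before and at most \<open>\<delta>\<close> after
  the shift, the expected number of visits is therefore at least \<open>\<sigma>\<^sup>2 ln (1 / (4 \<delta>)) / d\<^sup>2\<close>. Such a
  set, either the policies that visit the triple or those that do not, exists for some \<open>d\<close> with
  \<open>\<bar>d\<bar> \<le> x\<close>, for each \<open>x\<close> above twice the maximum in the bound. Finally, the expected visits themselves
  form a flow above the bound, and its value is the expected stopping time.
\<close>

section \<open>Ionescu-Tulcea measures\<close>

text \<open>The denominator is the size of the shift. To make a set of recommendations wrong, some
  policy outside it must get more than \<epsilon> ahead of it. This costs the distance to be caught
  up (a return gap, or \<epsilon>) plus another \<epsilon>, hence twice the maximum; strictness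
  forces a slack \<open>\<eta>\<close>, removed by a limit. The minimal gap matters only when every
  near-optimal policy visits the triple: raising such a triple invalidates no recommendation, and
  lowering it does so only once some policy off the triple has caught up. The 4 in the logarithm
  comes from the probability 1/2, since 1/2 ln(1/\<delta>) - ln 2 = 1/2 ln(1/(4\<delta>)). The
  probabilistic obstacle is that \<tau> may have infinite mean, so the log-likelihood ratio at
  \<tau> is not known to be integrable. All identities are therefore proved for the process stopped
  at the smaller of \<tau> and a fixed t, and t tends to infinity only in the final
  inequality.\<close>

lemma (in Ionescu_Tulcea) distr_lim_upto:
  "distr PF.lim (PiM {0..<n} M) (\<lambda>\<omega>. restrict \<omega> {0..<n}) = C 0 n (\<lambda>_. undefined)"
proof -
  \<comment> \<open>\<open>CI\<close> pushes the iterated kernel forward to a finite index set; over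
    an initial segment the cylinder embedding \<open>prod_emb\<close> is the identity.\<close>
  have "CI {0..<n} = C 0 n (\<lambda>_. undefined)"
  proof (rule measure_eqI)
    show "sets (CI {0..<n}) = sets (C 0 n (\<lambda>_. undefined))"
      by (simp add: CI_def sets_C)
    fix X assume "X \<in> sets (CI {0..<n})"
    then have X: "X \<in> sets (PiM {0..<n} M)" by (simp add: CI_def)
    show "emeasure (CI {0..<n}) X = emeasure (C 0 n (\<lambda>_. undefined)) X"
      using emeasure_CI[OF _ X, of n] prod_emb_id[of X "{0..<n}" M] sets.sets_into_space[OF X]
      by (simp add: space_PiM)
  qed
  then show ?thesis by (simp add: distr_lim)
qed

lemma (in Ionescu_Tulcea) restrict_measurable_lim [measurable]:
  "(\<lambda>\<omega>. restrict \<omega> {0..<n}) \<in> PF.lim \<rightarrow>\<^sub>M PiM {0..<n} M"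
  by (simp add: measurable_cong_sets[OF PF.sets_lim refl] measurable_restrict)

text \<open>The tower rule at coordinate \<open>n\<close>. Both sides integrate over the same
  infinite limit, so an induction on the number of observations never changes the measure; the
  finite marginals appear only inside the proof.\<close>

lemma (in Ionescu_Tulcea) nn_integral_lim_Suc:
  assumes f[measurable]: "f \<in> borel_measurable (PiM {0..<Suc n} M)"
  shows "(\<integral>\<^sup>+\<omega>. f (restrict \<omega> {0..<Suc n}) \<partial>PF.lim) =
    (\<integral>\<^sup>+\<omega>. (\<integral>\<^sup>+y. f ((restrict \<omega> {0..<n})(n := y)) \<partial>P n (restrict \<omega> {0..<n})) \<partial>PF.lim)"
proof -
  let ?C = "\<lambda>n. C 0 n (\<lambda>_. undefined)"
  have "(\<integral>\<^sup>+\<omega>. f (restrict \<omega> {0..<Suc n}) \<partial>PF.lim) = (\<integral>\<^sup>+x. f x \<partial>?C (Suc n))"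
    unfolding distr_lim_upto[symmetric]
    by (subst nn_integral_distr) (simp_all add: restrict_measurable_lim)
  also have "\<dots> = (\<integral>\<^sup>+x. (\<integral>\<^sup>+z. f z \<partial>eP n x) \<partial>?C n)"
    using measurable_eP[of n]
    by (auto simp: sets_C measurable_cong_sets[OF sets_C]  intro!: nn_integral_bind[where B="PiM {0..<Suc n} M"])
  also have "\<dots> = (\<integral>\<^sup>+x. (\<integral>\<^sup>+y. f (x(n := y)) \<partial>P n x) \<partial>?C n)"
    by (intro nn_integral_cong nn_integral_eP) (auto simp: space_C)
  also have "\<dots> = (\<integral>\<^sup>+\<omega>. (\<integral>\<^sup>+y. f ((restrict \<omega> {0..<n})(n := y)) \<partial>P n (restrict \<omega> {0..<n})) \<partial>PF.lim)"
  proof -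
    have "(\<lambda>x. \<integral>\<^sup>+z. f z \<partial>eP n x) \<in> borel_measurable (PiM {0..<n} M)"
      by measurable
    then have "(\<lambda>x. \<integral>\<^sup>+y. f (x(n := y)) \<partial>P n x) \<in> borel_measurable (PiM {0..<n} M)"
      by (rule measurable_cong[THEN iffD1, rotated]) (simp add: nn_integral_eP)
    then show ?thesis
      unfolding distr_lim_upto[symmetric]
      by (subst nn_integral_distr) (simp_all add: restrict_measurable_lim)
  qed
  finally show ?thesis .
qed

lemma (in Ionescu_Tulcea) prob_space_lim: "prob_space PF.lim"
proof -
  have "prob_space (distr PF.lim (PiM {0..<0} M) (\<lambda>\<omega>. restrict \<omega> {0..<0}))"
    unfolding distr_lim_upto by (rule prob_space_C) simp
  then show ?thesis by (rule prob_space_distrD[OF restrict_measurable_lim])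
qed

section \<open>The law of the interaction\<close>

lemma finite_policies: "finite (policies (D :: ('s::finite, 'a::finite) environment))"
  unfolding policies_def by (intro finite_PiE) auto

text \<open>Unlike \<open>policies_through\<close>, not intersected with \<open>policies D\<close>:
  membership of \<open>played alg l \<omega>\<close> can then be tested for every
  \<open>\<omega>\<close>.\<close>

definition visiting_policies ::
    "('s, 'a) environment \<Rightarrow> nat \<Rightarrow> 's \<Rightarrow> 'a \<Rightarrow> ('s, 'a) policy set" where
  "visiting_policies D h s a = {\<pi>. state_at D \<pi> h = s \<and> action_at D \<pi> h = a}"

locale interaction =
  fixes D :: "('s::finite, 'a::finite) environment"
    and \<nu> :: "('s, 'a) rewards"
    and alg :: "('s, 'a) algorithm"
    and \<sigma>2 :: real
  assumes pos_variance: "0 < \<sigma>2"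
    and gaussian: "(D, \<nu>) \<in> gaussian_mdps \<sigma>2"
    and algorithm: "valid_algorithm D alg"
begin

abbreviation "run \<equiv> run_measure D \<nu> alg"
abbreviation "obs \<equiv> obs_space D"
abbreviation "Kn \<equiv> obs_kernel D \<nu> alg"

lemma horizon_pos: "1 \<le> horizon D" and policies_nonempty: "policies D \<noteq> {}"
  using gaussian by (auto simp: gaussian_mdps_def valid_environment_def)

lemma reward_law:
  assumes "h \<in> {1..horizon D}"
  shows "\<nu> h s a = density lborel (normal_density (mean_reward \<nu> h s a) (sqrt \<sigma>2))"
  using gaussian assms by (auto simp: gaussian_mdps_def)

lemma prob_space_reward:
  assumes "h \<in> {1..horizon D}"
  shows "prob_space (\<nu> h s a)"
  by (subst reward_law[OF assms]) (use pos_variance in \<open>auto intro!: prob_space_normal_density\<close>)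

lemma sets_reward:
  assumes "h \<in> {1..horizon D}"
  shows "sets (\<nu> h s a) = sets borel"
  by (subst reward_law[OF assms]) simp

definition reward_product :: "('s, 'a) policy \<Rightarrow> (nat \<Rightarrow> real) measure" where
  "reward_product \<pi> = PiM {1..horizon D} (\<lambda>h. \<nu> h (state_at D \<pi> h) (action_at D \<pi> h))"

lemma prob_space_reward_product: "prob_space (reward_product \<pi>)"
  unfolding reward_product_def by (intro prob_space_PiM prob_space_reward)

lemma sets_reward_product: "t \<noteq> 0 \<Longrightarrow> sets (reward_product \<pi>) = sets (obs t)"
  unfolding reward_product_def obs_space_def by (auto intro!: sets_PiM_cong simp: sets_reward)

lemma kernel_pos: "0 < t \<Longrightarrow> Kn t \<omega> = reward_product (played alg t \<omega>)"
  by (simp add: obs_kernel_def reward_product_def)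

lemma played_restrict: "t \<le> n \<Longrightarrow> played alg t (restrict \<omega> {0..<n}) = played alg t \<omega>"
  by (simp add: played_def min_absorb2)

text \<open>The case \<open>t = n\<close> is included: the policy of episode \<open>n\<close> is
  fixed before observation \<open>n\<close> is drawn.\<close>

lemma played_upd: "t \<le> n \<Longrightarrow> played alg t (x(n := y)) = played alg t x"
  unfolding played_def by (rule arg_cong[where f="select alg t"]) (auto simp: fun_eq_iff)

lemma measurable_select:
  "0 < t \<Longrightarrow> select alg t \<in> PiM {0..<t} obs \<rightarrow>\<^sub>M count_space (policies D)"
  using algorithm by (auto simp: valid_algorithm_def)

lemma measurable_played:
  assumes "0 < t" "{0..<t} \<subseteq> J"
  shows "played alg t \<in> PiM J obs \<rightarrow>\<^sub>M count_space (policies D)"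
proof -
  have "(\<lambda>\<omega>. restrict \<omega> {0..<t}) \<in> PiM J obs \<rightarrow>\<^sub>M PiM {0..<t} obs"
    using assms(2) by (intro measurable_restrict measurable_component_singleton) auto
  from measurable_compose[OF this measurable_select[OF assms(1)]] show ?thesis
    by (simp add: played_def[abs_def])
qed

lemma played_in_policies:
  "0 < t \<Longrightarrow> \<omega> \<in> space (PiM UNIV obs) \<Longrightarrow> played alg t \<omega> \<in> policies D"
  using measurable_space[OF measurable_played[of t UNIV]] by fastforce

lemma prob_space_seed: "prob_space (seed alg)" and sets_seed: "sets (seed alg) = sets (obs 0)"
  using algorithm by (auto simp: valid_algorithm_def)

sublocale IT: Ionescu_Tulcea Kn obs
proof (rule Ionescu_Tulcea.intro)
  show "Kn i \<in> PiM {0..<i} obs \<rightarrow>\<^sub>M subprob_algebra (obs i)" for i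
  proof (cases "i = 0")
    case True
    have "(\<lambda>\<omega>. seed alg) \<in> PiM {0..<i} obs \<rightarrow>\<^sub>M subprob_algebra (obs 0)"
      using prob_space_seed sets_seed
      by (intro measurable_const) (auto simp: space_subprob_algebra prob_space_imp_subprob_space)
    then show ?thesis
      using True by (simp add: obs_kernel_def[abs_def])
  next
    case False
    \<comment> \<open>Every map out of a discrete space is measurable, so the kernel inherits
      measurability from the played policy alone.\<close>
    have "reward_product \<in> count_space (policies D) \<rightarrow>\<^sub>M subprob_algebra (obs i)"
      using False
      by (auto simp: space_subprob_algebra prob_space_reward_product sets_reward_product
          intro!: prob_space_imp_subprob_space)
    from measurable_compose[OF measurable_played this, of i "{0..<i}"] False show ?thesis
      by (simp add: kernel_pos cong: measurable_cong)
  qed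
  show "prob_space (Kn i \<omega>)" for i \<omega>
    by (cases "i = 0")
      (simp add: obs_kernel_def prob_space_seed, simp add: kernel_pos prob_space_reward_product)
qed

lemma run_eq: "run = IT.PF.lim"
  by (simp add: run_measure_def)

lemma sets_run [measurable_cong]: "sets run = sets (PiM UNIV obs)"
  by (simp add: run_eq)

lemma space_run: "space run = space (PiM UNIV obs)"
  by (simp add: run_eq)

sublocale prob_space run
  unfolding run_eq by (rule IT.prob_space_lim)

lemma nn_integral_run_Suc:
  assumes "f \<in> borel_measurable (PiM {0..<Suc n} obs)"
  shows "(\<integral>\<^sup>+\<omega>. f (restrict \<omega> {0..<Suc n}) \<partial>run) =
    (\<integral>\<^sup>+\<omega>. (\<integral>\<^sup>+y. f ((restrict \<omega> {0..<n})(n := y)) \<partial>Kn n \<omega>) \<partial>run)"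
proof -
  have "Kn n (restrict \<omega> {0..<n}) = Kn n \<omega>" for \<omega>
    by (simp add: obs_kernel_def played_restrict)
  with IT.nn_integral_lim_Suc[OF assms] show ?thesis
    by (simp add: run_eq)
qed

end

section \<open>Shifting one mean reward\<close>

text \<open>With equal variances the terms quadratic in \<open>y\<close> cancel. The log-density
  ratio is thus affine in the reward, and its mean needs only a first moment.\<close>

lemma normal_density_shift:
  assumes "0 < v"
  shows "normal_density (r + d) (sqrt v) y =
    normal_density r (sqrt v) y * exp (d / v * (y - r) - d\<^sup>2 / (2 * v))"
proof -
  have "- (y - (r + d))\<^sup>2 / (2 * v) = - (y - r)\<^sup>2 / (2 * v) + (d / v * (y - r) - d\<^sup>2 / (2 * v))"
    using assms by (simp add: field_simps power2_eq_square)
  then show ?thesis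
    using assms by (simp add: normal_density_def exp_add[symmetric])
qed

lemma nn_integral_PiM_density_component:
  fixes M N :: "'i \<Rightarrow> 'b measure"
  assumes I: "finite I" "i \<in> I"
    and M: "\<And>j. j \<in> I \<Longrightarrow> prob_space (M j)" and N: "prob_space (N i)"
    and same: "\<And>j. j \<in> I \<Longrightarrow> j \<noteq> i \<Longrightarrow> N j = M j"
    and dens: "N i = density (M i) g" and g[measurable]: "g \<in> borel_measurable (M i)"
    and f[measurable]: "f \<in> borel_measurable (PiM I M)"
  shows "(\<integral>\<^sup>+y. f y \<partial>PiM I N) = (\<integral>\<^sup>+y. f y * g (y i) \<partial>PiM I M)"
proof -
  \<comment> \<open>Outside \<open>I\<close> the factors are replaced by point masses, because
    Fubini for products is stated for families that are sigma-finite at every index.\<close>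
  define M' where "M' j = (if j \<in> I then M j else return (M i) (SOME x. x \<in> space (M i)))" for j
  define N' where "N' j = (if j = i then N i else M' j)" for j
  have nonempty: "space (M i) \<noteq> {}"
    using M[OF I(2)] by (rule prob_space.not_empty)
  have M': "prob_space (M' j)" for j
    using M nonempty by (auto simp: M'_def some_in_eq intro!: prob_space_return)
  then have N': "prob_space (N' j)" for j
    using N by (simp add: N'_def)
  interpret M': product_sigma_finite M'
    unfolding product_sigma_finite_def using M' by (blast intro: prob_space_imp_sigma_finite)
  interpret N': product_sigma_finite N'
    unfolding product_sigma_finite_def using N' by (blast intro: prob_space_imp_sigma_finite)
  define J where "J = I - {i}"
  have J: "finite J" "i \<notin> J" "insert i J = I"
    using I by (auto simp: J_def)
  have [simp]: "M' i = M i"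
    using I by (simp add: M'_def)
  have PM: "PiM I M = PiM (insert i J) M'"
    unfolding J by (intro PiM_cong) (auto simp: M'_def)
  have PN: "PiM I N = PiM (insert i J) N'"
    unfolding J using same by (intro PiM_cong) (auto simp: N'_def M'_def)
  have PJ: "PiM J N' = PiM J M'"
    using J by (intro PiM_cong) (auto simp: N'_def)
  have "sets (PiM I N) = sets (PiM I M)"
  proof (intro sets_PiM_cong refl)
    show "sets (N j) = sets (M j)" if "j \<in> I" for j
      using same[OF that] dens by (cases "j = i") auto
  qed
  then have fN: "f \<in> borel_measurable (PiM I N)"
    using f by (simp cong: measurable_cong_sets)
  have gM: "(\<lambda>y. f y * g (y i)) \<in> borel_measurable (PiM I M)"
    using I by measurable
  have upd: "(\<lambda>y. f (x(i := y))) \<in> borel_measurable (M i)" if "x \<in> space (PiM J M')" for x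
  proof -
    have "(\<lambda>y. x(i := y)) \<in> M' i \<rightarrow>\<^sub>M PiM (insert i J) M'"
      using that J by (intro measurable_fun_upd[where J=J]) auto
    then show ?thesis
      using measurable_compose[OF _ f] by (simp add: PM)
  qed
  have "(\<integral>\<^sup>+y. f y \<partial>PiM I N) = (\<integral>\<^sup>+x. (\<integral>\<^sup>+y. f (x(i := y)) \<partial>N i) \<partial>PiM J M')"
    unfolding PN using fN unfolding PN
    by (subst N'.product_nn_integral_insert) (use J in \<open>auto simp: PJ N'_def\<close>)
  also have "\<dots> = (\<integral>\<^sup>+x. (\<integral>\<^sup>+y. f (x(i := y)) * g y \<partial>M i) \<partial>PiM J M')"
    unfolding dens
    by (intro nn_integral_cong) (use upd in \<open>auto simp: nn_integral_density mult.commute\<close>)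
  also have "\<dots> = (\<integral>\<^sup>+y. f y * g (y i) \<partial>PiM I M)"
    unfolding PM using gM unfolding PM
    by (subst M'.product_nn_integral_insert) (use J in auto)
  finally show ?thesis .
qed

definition shift_mean ::
    "('s, 'a) rewards \<Rightarrow> real \<Rightarrow> nat \<Rightarrow> 's \<Rightarrow> 'a \<Rightarrow> real \<Rightarrow> ('s, 'a) rewards" where
  "shift_mean \<nu> \<sigma>2 h s a d = (\<lambda>h' s' a'. if h' = h \<and> s' = s \<and> a' = a
     then density lborel (normal_density (mean_reward \<nu> h s a + d) (sqrt \<sigma>2)) else \<nu> h' s' a')"

lemma mean_reward_shift_mean:
  assumes "0 < \<sigma>2"
  shows "mean_reward (shift_mean \<nu> \<sigma>2 h s a d) h' s' a' =
    mean_reward \<nu> h' s' a' + (if h' = h \<and> s' = s \<and> a' = a then d else 0)"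
  using assms
  by (auto simp: mean_reward_def shift_mean_def integral_density integral_normal_moment_nz_1)

lemma gaussian_shift_mean:
  assumes "0 < \<sigma>2" "(D, \<nu>) \<in> gaussian_mdps \<sigma>2"
  shows "(D, shift_mean \<nu> \<sigma>2 h s a d) \<in> gaussian_mdps \<sigma>2"
proof -
  have "shift_mean \<nu> \<sigma>2 h s a d h' s' a' = density lborel
      (normal_density (mean_reward (shift_mean \<nu> \<sigma>2 h s a d) h' s' a') (sqrt \<sigma>2))"
    if "h' \<in> {1..horizon D}" for h' s' a'
    using assms that
    by (subst mean_reward_shift_mean) (auto simp: shift_mean_def gaussian_mdps_def)
  then show ?thesis
    using assms by (auto simp: gaussian_mdps_def)
qed

text \<open>A trajectory passes stage \<open>h\<close> exactly once and does not depend on the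
  rewards, so the shift is collected once or not at all.\<close>

lemma policy_return_shift_mean:
  assumes "0 < \<sigma>2" "h \<in> {1..horizon D}"
  shows "policy_return D (shift_mean \<nu> \<sigma>2 h s a d) \<pi> =
    policy_return D \<nu> \<pi> + (if \<pi> \<in> visiting_policies D h s a then d else 0)"
proof -
  let ?x = "if state_at D \<pi> h = s \<and> action_at D \<pi> h = a then d else 0"
  have "policy_return D (shift_mean \<nu> \<sigma>2 h s a d) \<pi> =
    policy_return D \<nu> \<pi> + (\<Sum>h'=1..horizon D. if h' = h then ?x else 0)"
    unfolding policy_return_def mean_reward_shift_mean[OF assms(1)] sum.distrib
    by (intro arg_cong2[where f="(+)"] sum.cong) auto
  also have "(\<Sum>h'=1..horizon D. if h' = h then ?x else 0) = ?x"
    using assms(2) by (subst sum.delta) auto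
  finally show ?thesis
    by (simp add: visiting_policies_def)
qed

section \<open>Change of measure after a fixed number of observations\<close>

locale shifted_interaction = interaction D \<nu> alg \<sigma>2
  for D :: "('s::finite, 'a::finite) environment"
    and \<nu> :: "('s, 'a) rewards"
    and alg :: "('s, 'a) algorithm"
    and \<sigma>2 :: real +
  fixes h :: nat and s :: 's and a :: 'a and d :: real
  assumes stage: "h \<in> {1..horizon D}"
begin

abbreviation "\<nu>' \<equiv> shift_mean \<nu> \<sigma>2 h s a d"
abbreviation "visiting \<equiv> visiting_policies D h s a"
abbreviation "r \<equiv> mean_reward \<nu> h s a"

sublocale Q: interaction D \<nu>' alg \<sigma>2
  by (rule interaction.intro[OF pos_variance gaussian_shift_mean[OF pos_variance gaussian] algorithm])

definition log_ratio :: "real \<Rightarrow> real" where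
  "log_ratio y = d / \<sigma>2 * (y - r) - d\<^sup>2 / (2 * \<sigma>2)"

text \<open>Coordinate 0 carries the seed of the learner, whose law is the same in both models;
  hence the guard \<open>0 < l\<close>.\<close>

definition log_step :: "nat \<Rightarrow> history \<Rightarrow> real" where
  "log_step l \<omega> = (if 0 < l \<and> played alg l \<omega> \<in> visiting then log_ratio (\<omega> l h) else 0)"

text \<open>Counts coordinates, not episodes: \<open>likelihood (Suc k)\<close> covers the seed and
  the episodes \<open>1..k\<close>.\<close>

definition likelihood :: "nat \<Rightarrow> history \<Rightarrow> real" where
  "likelihood n \<omega> = exp (\<Sum>l<n. log_step l \<omega>)"

lemma measurable_log_ratio [measurable]: "log_ratio \<in> borel_measurable borel"
  unfolding log_ratio_def[abs_def] by measurable

lemma shifted_law: "\<nu>' h s a = density (\<nu> h s a) (\<lambda>y. ennreal (exp (log_ratio y)))"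
proof -
  have "\<nu>' h s a = density lborel (\<lambda>y. ennreal (normal_density r (sqrt \<sigma>2) y) * ennreal (exp (log_ratio y)))"
    using pos_variance
    by (simp add: shift_mean_def normal_density_shift log_ratio_def ennreal_mult')
  also have "\<dots> = density (density lborel (normal_density r (sqrt \<sigma>2))) (\<lambda>y. ennreal (exp (log_ratio y)))"
    by (subst density_density_eq) auto
  also have "\<dots> = density (\<nu> h s a) (\<lambda>y. ennreal (exp (log_ratio y)))"
    using reward_law[OF stage] by simp
  finally show ?thesis .
qed

lemma nn_integral_shifted_kernel:
  assumes "0 < n" and f: "f \<in> borel_measurable (obs n)"
  shows "(\<integral>\<^sup>+y. f y \<partial>Q.Kn n \<omega>) =
    (\<integral>\<^sup>+y. f y * (if played alg n \<omega> \<in> visiting then ennreal (exp (log_ratio (y h))) else 1) \<partial>Kn n \<omega>)"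
proof -
  define \<pi> where "\<pi> = played alg n \<omega>"
  let ?M = "\<lambda>j. \<nu> j (state_at D \<pi> j) (action_at D \<pi> j)"
  let ?N = "\<lambda>j. \<nu>' j (state_at D \<pi> j) (action_at D \<pi> j)"
  have Kn: "Kn n \<omega> = PiM {1..horizon D} ?M" "Q.Kn n \<omega> = PiM {1..horizon D} ?N"
    using \<open>0 < n\<close> by (simp_all add: kernel_pos Q.kernel_pos reward_product_def Q.reward_product_def \<pi>_def)
  show ?thesis
  proof (cases "\<pi> \<in> visiting")
    case True
    then have \<pi>: "state_at D \<pi> h = s" "action_at D \<pi> h = a"
      by (auto simp: visiting_policies_def)
    have "(\<integral>\<^sup>+y. f y \<partial>PiM {1..horizon D} ?N) =
        (\<integral>\<^sup>+y. f y * ennreal (exp (log_ratio (y h))) \<partial>PiM {1..horizon D} ?M)"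
    proof (rule nn_integral_PiM_density_component[where M="?M" and N="?N" and i=h
          and g="\<lambda>y. ennreal (exp (log_ratio y))"])
      show "prob_space (?M j)" if "j \<in> {1..horizon D}" for j
        by (rule prob_space_reward[OF that])
      show "prob_space (?N h)"
        by (rule Q.prob_space_reward[OF stage])
      show "?N j = ?M j" if "j \<noteq> h" for j
        using that by (simp add: shift_mean_def)
      show "?N h = density (?M h) (\<lambda>y. ennreal (exp (log_ratio y)))"
        unfolding \<pi> by (rule shifted_law)
      show "(\<lambda>y. ennreal (exp (log_ratio y))) \<in> borel_measurable (?M h)"
        unfolding measurable_cong_sets[OF sets_reward[OF stage] refl] by measurable
      show "f \<in> borel_measurable (PiM {1..horizon D} ?M)"
        using f \<open>0 < n\<close> sets_reward_product[of n \<pi>] unfolding reward_product_def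
        by (simp cong: measurable_cong_sets)
    qed (use stage in auto)
    then show ?thesis
      using True by (simp add: Kn \<pi>_def)
  next
    case False
    then have "PiM {1..horizon D} ?N = PiM {1..horizon D} ?M"
      by (intro PiM_cong) (auto simp: shift_mean_def visiting_policies_def)
    then show ?thesis
      using False by (simp add: Kn \<pi>_def)
  qed
qed

lemma measurable_reward:
  assumes "0 < l" "l \<in> J"
  shows "(\<lambda>\<omega>. \<omega> l h) \<in> borel_measurable (PiM J obs)"
proof -
  have "(\<lambda>y. y h) \<in> borel_measurable (obs l)"
    using stage assms by (auto simp: obs_space_def)
  then show ?thesis
    by (rule measurable_compose[OF measurable_component_singleton[OF assms(2)]])
qed

lemma measurable_visiting:
  assumes "0 < l" "{0..<l} \<subseteq> J"
  shows "Measurable.pred (PiM J obs) (\<lambda>\<omega>. played alg l \<omega> \<in> visiting)"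
  by (rule measurable_compose[OF measurable_played[OF assms]]) simp

lemma measurable_log_step:
  assumes "{0..<Suc l} \<subseteq> J"
  shows "log_step l \<in> borel_measurable (PiM J obs)"
proof (cases "l = 0")
  case False
  have "{0..<l} \<subseteq> J" "l \<in> J"
    using assms by auto
  then have [measurable]: "Measurable.pred (PiM J obs) (\<lambda>\<omega>. played alg l \<omega> \<in> visiting)"
    "(\<lambda>\<omega>. \<omega> l h) \<in> borel_measurable (PiM J obs)"
    using False measurable_visiting measurable_reward by auto
  show ?thesis
    unfolding log_step_def[abs_def] by measurable
qed (simp add: log_step_def[abs_def])

lemma measurable_likelihood:
  assumes "{0..<n} \<subseteq> J"
  shows "likelihood n \<in> borel_measurable (PiM J obs)"
proof -
  have "(\<lambda>\<omega>. \<Sum>l<n. log_step l \<omega>) \<in> borel_measurable (PiM J obs)"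
    using assms by (intro borel_measurable_sum measurable_log_step) auto
  then show ?thesis
    unfolding likelihood_def[abs_def] by measurable
qed

lemma likelihood_restrict: "likelihood n (restrict \<omega> {0..<n}) = likelihood n \<omega>"
  unfolding likelihood_def log_step_def by (auto intro!: sum.cong simp: played_restrict)

lemma likelihood_upd: "likelihood n (x(n := y)) = likelihood n x"
  unfolding likelihood_def log_step_def by (auto intro!: sum.cong simp: played_upd)

lemma likelihood_nonneg: "0 \<le> likelihood n \<omega>"
  by (simp add: likelihood_def)

lemma likelihood_Suc: "likelihood (Suc n) \<omega> = likelihood n \<omega> * exp (log_step n \<omega>)"
  by (simp add: likelihood_def exp_add)

text \<open>Peel off the last coordinate: integrate it out under the shifted kernel, move the
  remaining prefix to the original law by induction, then turn the shifted kernel into the original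
  one with its density. The function \<open>f\<close> is arbitrary in the induction because the
  hypothesis is applied to the partial integral \<open>G\<close>.\<close>

lemma nn_integral_shifted_run:
  assumes "f \<in> borel_measurable (PiM {0..<n} obs)"
  shows "(\<integral>\<^sup>+\<omega>. f (restrict \<omega> {0..<n}) \<partial>Q.run) =
    (\<integral>\<^sup>+\<omega>. f (restrict \<omega> {0..<n}) * likelihood n \<omega> \<partial>run)"
  using assms
proof (induction n arbitrary: f)
  case 0
  then show ?case
    by (simp add: likelihood_def restrict_def emeasure_space_1 Q.emeasure_space_1)
next
  case (Suc n)
  note f[measurable] = Suc.prems
  define G where "G x = (\<integral>\<^sup>+y. f (x(n := y)) \<partial>Q.Kn n x)" for x
  have upd: "(\<lambda>(x, y). x(n := y)) \<in> PiM {0..<n} obs \<Otimes>\<^sub>M obs n \<rightarrow>\<^sub>M PiM {0..<Suc n} obs"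
    by (auto simp: measurable_split_conv intro!: measurable_fun_upd[where J="{0..<n}"])
  have "(\<lambda>(x, y). f (x(n := y))) \<in> borel_measurable (PiM {0..<n} obs \<Otimes>\<^sub>M obs n)"
  proof -
    have "(\<lambda>(x, y). f (x(n := y))) = (\<lambda>z. f ((\<lambda>(x, y). x(n := y)) z))"
      by (auto simp: fun_eq_iff)
    then show ?thesis
      using measurable_compose[OF upd f] by simp
  qed
  then have G: "G \<in> borel_measurable (PiM {0..<n} obs)"
    unfolding G_def by (intro nn_integral_measurable_subprob_algebra2[OF _ Q.IT.P])
  have "(\<integral>\<^sup>+\<omega>. f (restrict \<omega> {0..<Suc n}) \<partial>Q.run) = (\<integral>\<^sup>+\<omega>. G (restrict \<omega> {0..<n}) \<partial>Q.run)"
  proof -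
    have "Q.Kn n (restrict \<omega> {0..<n}) = Q.Kn n \<omega>" for \<omega>
      by (simp add: obs_kernel_def played_restrict)
    then show ?thesis
      unfolding Q.nn_integral_run_Suc[OF f] G_def by simp
  qed
  also have "\<dots> = (\<integral>\<^sup>+\<omega>. G (restrict \<omega> {0..<n}) * likelihood n \<omega> \<partial>run)"
    by (rule Suc.IH[OF G])
  also have "\<dots> = (\<integral>\<^sup>+\<omega>. (\<integral>\<^sup>+y. f ((restrict \<omega> {0..<n})(n := y)) *
      likelihood (Suc n) ((restrict \<omega> {0..<n})(n := y)) \<partial>Kn n \<omega>) \<partial>run)"
  proof (rule nn_integral_cong)
    fix \<omega> assume \<omega>: "\<omega> \<in> space run"
    define x where "x = restrict \<omega> {0..<n}"
    have x: "x \<in> space (PiM {0..<n} obs)"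
      using \<omega> by (auto simp: x_def space_run space_PiM)
    have Kx: "Kn n x = Kn n \<omega>"
      by (simp add: obs_kernel_def played_restrict x_def)
    have sets_K: "sets (Kn n x) = sets (obs n)"
      using IT.sets_P[OF x] .
    have fx: "(\<lambda>y. f (x(n := y))) \<in> borel_measurable (obs n)"
      using measurable_compose[OF measurable_Pair1'[OF x] upd] f
      by (auto intro: measurable_compose)
    have G_eq: "G x = (\<integral>\<^sup>+y. f (x(n := y)) * exp (log_step n (x(n := y))) \<partial>Kn n x)"
    proof (cases "n = 0")
      case True
      then show ?thesis by (simp add: G_def obs_kernel_def log_step_def)
    next
      case False
      then show ?thesis
        unfolding G_def
        by (subst nn_integral_shifted_kernel[OF _ fx])
           (auto intro!: nn_integral_cong simp: log_step_def played_upd)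
    qed
    have m: "(\<lambda>y. f (x(n := y)) * ennreal (exp (log_step n (x(n := y))))) \<in> borel_measurable (Kn n x)"
    proof -
      have "(\<lambda>y. log_step n (x(n := y))) \<in> borel_measurable (obs n)"
        using measurable_compose[OF measurable_compose[OF measurable_Pair1'[OF x] upd]
            measurable_log_step[of n "{0..<Suc n}"]] by simp
      then show ?thesis
        using fx unfolding measurable_cong_sets[OF sets_K refl] by measurable
    qed
    have "G x * likelihood n \<omega> =
      (\<integral>\<^sup>+y. f (x(n := y)) * exp (log_step n (x(n := y))) * likelihood n \<omega> \<partial>Kn n x)"
      unfolding G_eq using m by (rule nn_integral_multc[symmetric])
    also have "\<dots> = (\<integral>\<^sup>+y. f (x(n := y)) * likelihood (Suc n) (x(n := y)) \<partial>Kn n x)"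
    proof (rule nn_integral_cong)
      fix y
      have "likelihood n (x(n := y)) = likelihood n \<omega>"
        unfolding likelihood_upd unfolding x_def by (rule likelihood_restrict)
      then have "ennreal (likelihood (Suc n) (x(n := y))) =
          ennreal (exp (log_step n (x(n := y)))) * ennreal (likelihood n \<omega>)"
        by (simp add: likelihood_Suc ennreal_mult' likelihood_nonneg mult.commute)
      then show "f (x(n := y)) * exp (log_step n (x(n := y))) * likelihood n \<omega> =
          f (x(n := y)) * likelihood (Suc n) (x(n := y))"
        by (simp only: mult.assoc)
    qed
    finally show "G (restrict \<omega> {0..<n}) * likelihood n \<omega> =
      (\<integral>\<^sup>+y. f ((restrict \<omega> {0..<n})(n := y)) *
        likelihood (Suc n) ((restrict \<omega> {0..<n})(n := y)) \<partial>Kn n \<omega>)"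
      by (simp add: x_def[symmetric] Kx)
  qed
  also have "\<dots> = (\<integral>\<^sup>+\<omega>. f (restrict \<omega> {0..<Suc n}) * likelihood (Suc n) (restrict \<omega> {0..<Suc n}) \<partial>run)"
  proof (rule nn_integral_run_Suc[symmetric])
    have [measurable]: "likelihood (Suc n) \<in> borel_measurable (PiM {0..<Suc n} obs)"
      by (rule measurable_likelihood) simp
    show "(\<lambda>x. f x * ennreal (likelihood (Suc n) x)) \<in> borel_measurable (PiM {0..<Suc n} obs)"
      by measurable
  qed
  finally show ?case
    by (simp only: likelihood_restrict)
qed

end

section \<open>Stopping\<close>

lemma sets_info_mono:
  assumes "e \<le> e'"
  shows "sets (info D e) \<subseteq> sets (info D e')"
proof
  let ?\<Omega> = "space (PiM UNIV (obs_space D))"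
  let ?r = "\<lambda>e \<omega>. restrict \<omega> {t. enat t \<le> e}"
  let ?P = "\<lambda>e. PiM {t. enat t \<le> e} (obs_space D)"
  have r: "?r e \<in> ?\<Omega> \<rightarrow> space (?P e)" for e
    by (auto simp: space_PiM)
  fix B assume "B \<in> sets (info D e)"
  then obtain A where A: "A \<in> sets (?P e)" "B = ?r e -` A \<inter> ?\<Omega>"
    by (auto simp: info_def sets_vimage_algebra2[OF r])
  have sub: "{t. enat t \<le> e} \<subseteq> {t. enat t \<le> e'}"
    using assms by auto
  have "?r e \<in> ?P e' \<rightarrow>\<^sub>M ?P e"
    using sub by (intro measurable_restrict measurable_component_singleton) auto
  then have "?r e -` A \<inter> space (?P e') \<in> sets (?P e')"
    using A by auto
  moreover have "B = ?r e' -` (?r e -` A \<inter> space (?P e')) \<inter> ?\<Omega>"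
    using sub r[of e'] by (auto simp: A inf.absorb2)
  ultimately show "B \<in> sets (info D e')"
    unfolding info_def sets_vimage_algebra2[OF r] by blast
qed

text \<open>The information after episode \<open>k\<close> consists of \<open>Suc k\<close>
  coordinates, the seed included; this is the index shift between \<open>info\<close> and
  \<open>likelihood\<close>.\<close>

lemma sets_info_enat:
  assumes "B \<in> sets (info D (enat k))"
  obtains A where "A \<in> sets (PiM {0..<Suc k} (obs_space D))"
    "B = {\<omega> \<in> space (PiM UNIV (obs_space D)). restrict \<omega> {0..<Suc k} \<in> A}"
proof -
  have k: "{t. enat t \<le> enat k} = {0..<Suc k}"
    by auto
  have r: "(\<lambda>\<omega>. restrict \<omega> {0..<Suc k}) \<in> space (PiM UNIV (obs_space D)) \<rightarrow>
      space (PiM {0..<Suc k} (obs_space D))"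
    by (auto simp: space_PiM)
  from assms that show thesis
    unfolding info_def k sets_vimage_algebra2[OF r] by auto
qed

context interaction
begin

abbreviation "\<Omega> \<equiv> space (PiM UNIV obs)"
abbreviation "\<tau> \<equiv> stop_time alg"

sublocale info: filtration \<Omega> "info D"
  by (rule filtration.intro) (auto simp: info_def dest: sets_info_mono[THEN subsetD])

lemma stopping_time: "stopping_time (info D) \<tau>"
  using algorithm by (simp add: valid_algorithm_def)

lemma stop_time_pos: "\<omega> \<in> \<Omega> \<Longrightarrow> 1 \<le> \<tau> \<omega>"
  using algorithm by (simp add: valid_algorithm_def)

lemma sets_run_history:
  assumes "A \<in> sets (PiM {0..<l} obs)"
  shows "{\<omega> \<in> \<Omega>. restrict \<omega> {0..<l} \<in> A} \<in> sets run"
proof -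
  have "(\<lambda>\<omega>. restrict \<omega> {0..<l}) \<in> PiM UNIV obs \<rightarrow>\<^sub>M PiM {0..<l} obs"
    by (intro measurable_restrict measurable_component_singleton) auto
  from measurable_sets[OF this assms] show ?thesis
    unfolding sets_run by (simp add: vimage_def Int_def conj_commute)
qed

lemma sets_info_sets_run:
  assumes "B \<in> sets (info D (enat k))"
  shows "B \<in> sets run"
  by (rule sets_info_enat[OF assms]) (simp only: sets_run_history)

lemma stop_time_le_info: "{\<omega> \<in> \<Omega>. \<tau> \<omega> \<le> e} \<in> sets (info D e)"
  using stopping_timeD[OF stopping_time, of e] by (simp add: pred_def info.space_F)

lemma recommend_info:
  assumes "E \<subseteq> policies D"
  shows "{\<omega> \<in> \<Omega>. recommend alg \<omega> \<in> E \<and> \<tau> \<omega> \<le> e} \<in> sets (info D e)"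
proof -
  have "recommend alg \<in> info.pre_sigma \<tau> \<rightarrow>\<^sub>M count_space (policies D)"
    using algorithm by (simp add: valid_algorithm_def)
  then have "recommend alg -` E \<inter> \<Omega> \<in> sets (info.pre_sigma \<tau>)"
    using assms measurable_sets[of "recommend alg" "info.pre_sigma \<tau>" "count_space (policies D)" E]
    by (simp add: info.space_pre_sigma)
  from info.sets_pre_sigmaD[OF stopping_time this, of e] show ?thesis
    by (simp add: vimage_def Int_def conj_ac)
qed

text \<open>Subtract the event for the predecessor of \<open>k\<close>. For \<open>k = 0\<close>
  there is none, but the event is empty because at least one episode is played.\<close>

lemma stopped_at_info:
  assumes "\<And>k. {\<omega> \<in> \<Omega>. P \<omega> \<and> \<tau> \<omega> \<le> enat k} \<in> sets (info D (enat k))"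
  shows "{\<omega> \<in> \<Omega>. P \<omega> \<and> \<tau> \<omega> = enat k} \<in> sets (info D (enat k))"
proof (cases k)
  case 0
  then have "{\<omega> \<in> \<Omega>. P \<omega> \<and> \<tau> \<omega> = enat k} = {}"
    using stop_time_pos by (force simp: zero_enat_def[symmetric])
  then show ?thesis
    by (metis sets.empty_sets)
next
  case (Suc j)
  have "{\<omega> \<in> \<Omega>. P \<omega> \<and> \<tau> \<omega> \<le> enat j} \<in> sets (info D (enat k))"
    using assms[of j] sets_info_mono[of "enat j" "enat k" D] Suc by auto
  with assms[of k]
  have "{\<omega> \<in> \<Omega>. P \<omega> \<and> \<tau> \<omega> \<le> enat k} - {\<omega> \<in> \<Omega>. P \<omega> \<and> \<tau> \<omega> \<le> enat j} \<in> sets (info D (enat k))"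
    by (rule sets.Diff)
  also have "{\<omega> \<in> \<Omega>. P \<omega> \<and> \<tau> \<omega> \<le> enat k} - {\<omega> \<in> \<Omega>. P \<omega> \<and> \<tau> \<omega> \<le> enat j} =
      {\<omega> \<in> \<Omega>. P \<omega> \<and> \<tau> \<omega> = enat k}"
  proof -
    have "x \<le> enat k \<and> \<not> x \<le> enat j \<longleftrightarrow> x = enat k" for x
      using Suc by (cases x) auto
    then show ?thesis by blast
  qed
  finally show ?thesis .
qed

lemma measurable_stop_time: "\<tau> \<in> run \<rightarrow>\<^sub>M count_space UNIV"
proof (subst measurable_count_space_eq_countable)
  have *: "{\<omega> \<in> \<Omega>. \<tau> \<omega> = enat k} \<in> sets run" for k
    using sets_info_sets_run[OF stopped_at_info[of "\<lambda>_. True"]] stop_time_le_info by simp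
  have "\<tau> -` {e} \<inter> space run \<in> sets run" for e
  proof (cases e)
    case (enat k)
    then show ?thesis
      using *[of k] by (simp add: vimage_def Int_def space_run conj_commute)
  next
    case infinity
    have "\<Omega> - (\<Union>k. {\<omega> \<in> \<Omega>. \<tau> \<omega> = enat k}) \<in> sets run"
      using * by (auto simp flip: space_run)
    also have "\<Omega> - (\<Union>k. {\<omega> \<in> \<Omega>. \<tau> \<omega> = enat k}) = \<tau> -` {e} \<inter> space run"
      using infinity by (auto simp: space_run)
    finally show ?thesis .
  qed
  then show "\<tau> \<in> space run \<rightarrow> UNIV \<and> (\<forall>a\<in>UNIV. \<tau> -` {a} \<inter> space run \<in> sets run)"
    by simp
qed (rule countableI_type)

text \<open>Predictability: whether episode \<open>l\<close> takes place is decided by the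
  coordinates below \<open>l\<close>, as the complement of stopping by time
  \<open>l - 1\<close>.\<close>

lemma episode_history:
  assumes "0 < l"
  obtains A where "A \<in> sets (PiM {0..<l} obs)"
    "{\<omega> \<in> \<Omega>. enat l \<le> \<tau> \<omega>} = {\<omega> \<in> \<Omega>. restrict \<omega> {0..<l} \<in> A}"
proof -
  obtain k where k: "l = Suc k"
    using assms by (cases l) auto
  obtain A where A: "A \<in> sets (PiM {0..<l} obs)"
    "{\<omega> \<in> \<Omega>. \<tau> \<omega> \<le> enat k} = {\<omega> \<in> \<Omega>. restrict \<omega> {0..<l} \<in> A}"
    unfolding k by (rule sets_info_enat[OF stop_time_le_info])
  have "enat l \<le> x \<longleftrightarrow> \<not> x \<le> enat k" for x
    using k by (cases x) auto
  then have "{\<omega> \<in> \<Omega>. enat l \<le> \<tau> \<omega>} = \<Omega> - {\<omega> \<in> \<Omega>. \<tau> \<omega> \<le> enat k}"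
    by auto
  also have "\<dots> = {\<omega> \<in> \<Omega>. restrict \<omega> {0..<l} \<in> space (PiM {0..<l} obs) - A}"
    unfolding A(2) by (auto simp: space_PiM)
  finally show thesis
    using A(1) by (intro that[of "space (PiM {0..<l} obs) - A"]) auto
qed

end

section \<open>Change of measure at the stopping time\<close>

context shifted_interaction
begin

lemma emeasure_shifted_run_info:
  assumes "B \<in> sets (info D (enat k))"
  shows "emeasure Q.run B = (\<integral>\<^sup>+\<omega>. indicator B \<omega> * ennreal (likelihood (Suc k) \<omega>) \<partial>run)"
proof -
  obtain A where A: "A \<in> sets (PiM {0..<Suc k} obs)"
    "B = {\<omega> \<in> \<Omega>. restrict \<omega> {0..<Suc k} \<in> A}"
    by (rule sets_info_enat[OF assms])
  have ind: "indicator A (restrict \<omega> {0..<Suc k}) = (indicator B \<omega> :: ennreal)" if "\<omega> \<in> \<Omega>" for \<omega>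
    using that by (auto simp: A(2) indicator_def)
  have "emeasure Q.run B = (\<integral>\<^sup>+\<omega>. indicator B \<omega> \<partial>Q.run)"
    using Q.sets_info_sets_run[OF assms] by simp
  also have "\<dots> = (\<integral>\<^sup>+\<omega>. indicator A (restrict \<omega> {0..<Suc k}) \<partial>Q.run)"
    by (intro nn_integral_cong) (simp add: ind Q.space_run)
  also have "\<dots> = (\<integral>\<^sup>+\<omega>. indicator A (restrict \<omega> {0..<Suc k}) * ennreal (likelihood (Suc k) \<omega>) \<partial>run)"
    using A(1) by (intro nn_integral_shifted_run) simp
  also have "\<dots> = (\<integral>\<^sup>+\<omega>. indicator B \<omega> * ennreal (likelihood (Suc k) \<omega>) \<partial>run)"
    by (intro nn_integral_cong) (simp add: ind space_run)
  finally show ?thesis .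
qed

text \<open>The log-likelihood ratio at the smaller of \<open>\<tau> \<omega>\<close> and
  \<open>t\<close>. Written as a sum with predictable indicators, its mean can be computed term by
  term, and the truncation makes it integrable whatever the tail of \<tau>.\<close>

definition stopped_log :: "nat \<Rightarrow> history \<Rightarrow> real" where
  "stopped_log t \<omega> = (\<Sum>l=1..t. if enat l \<le> \<tau> \<omega> then log_step l \<omega> else 0)"

lemma likelihood_eq: "likelihood (Suc k) \<omega> = exp (\<Sum>l=1..k. log_step l \<omega>)"
proof -
  have "{..<Suc k} = insert 0 {1..k}" by auto
  then show ?thesis by (simp add: likelihood_def log_step_def)
qed

lemma stopped_log_stopped:
  assumes "\<tau> \<omega> = enat k" "k \<le> t"
  shows "exp (stopped_log t \<omega>) = likelihood (Suc k) \<omega>"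
proof -
  have "stopped_log t \<omega> = (\<Sum>l\<in>{1..t} \<inter> {l. enat l \<le> \<tau> \<omega>}. log_step l \<omega>)"
    by (simp add: stopped_log_def sum.inter_restrict)
  also have "{1..t} \<inter> {l. enat l \<le> \<tau> \<omega>} = {1..k}"
    using assms by auto
  finally show ?thesis by (simp add: likelihood_eq)
qed

lemma stopped_log_running:
  assumes "enat t < \<tau> \<omega>"
  shows "exp (stopped_log t \<omega>) = likelihood (Suc t) \<omega>"
proof -
  have "enat l \<le> \<tau> \<omega>" if "l \<le> t" for l
    using assms that by (metis dual_order.strict_trans2 enat_ord_simps(1) less_imp_le)
  then show ?thesis
    unfolding stopped_log_def likelihood_eq by (intro arg_cong[where f=exp] sum.cong) auto
qed

lemma measurable_stopped_log: "stopped_log t \<in> borel_measurable run"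
proof -
  have [measurable]: "\<tau> \<in> run \<rightarrow>\<^sub>M count_space UNIV"
    by (rule measurable_stop_time)
  have [measurable]: "log_step l \<in> borel_measurable run" for l
    using measurable_log_step[of l UNIV] by (simp cong: measurable_cong_sets add: sets_run)
  show ?thesis
    unfolding stopped_log_def[abs_def] by measurable
qed

text \<open>Cut the event into the slices \<open>\<tau> \<omega> = enat k\<close> with
  \<open>k \<le> t\<close>. On each of them the stopped ratio is \<open>likelihood (Suc k)\<close>,
  so the change of measure at the fixed time \<open>k\<close> applies.\<close>

lemma emeasure_shifted_run_stopped:
  assumes P: "\<And>k. {\<omega> \<in> \<Omega>. P \<omega> \<and> \<tau> \<omega> \<le> enat k} \<in> sets (info D (enat k))"
  shows "emeasure Q.run {\<omega> \<in> \<Omega>. P \<omega> \<and> \<tau> \<omega> \<le> enat t} =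
    (\<integral>\<^sup>+\<omega>. indicator {\<omega> \<in> \<Omega>. P \<omega> \<and> \<tau> \<omega> \<le> enat t} \<omega> * ennreal (exp (stopped_log t \<omega>)) \<partial>run)"
proof -
  define B where "B k = {\<omega> \<in> \<Omega>. P \<omega> \<and> \<tau> \<omega> = enat k}" for k
  have B: "B k \<in> sets (info D (enat k))" for k
    unfolding B_def by (rule stopped_at_info[OF P])
  have un: "{\<omega> \<in> \<Omega>. P \<omega> \<and> \<tau> \<omega> \<le> enat t} = (\<Union>k\<in>{..t}. B k)"
  proof -
    have "x \<le> enat t \<longleftrightarrow> (\<exists>k\<le>t. x = enat k)" for x
      by (cases x) auto
    then show ?thesis by (auto simp: B_def)
  qed
  have disj: "disjoint_family_on B {..t}"
    by (auto simp: disjoint_family_on_def B_def)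
  have [measurable]: "B k \<in> sets run" for k
    by (rule sets_info_sets_run[OF B])
  have [measurable]: "stopped_log t \<in> borel_measurable run"
    by (rule measurable_stopped_log)
  have "emeasure Q.run (\<Union>k\<in>{..t}. B k) = (\<Sum>k\<le>t. emeasure Q.run (B k))"
    using disj Q.sets_info_sets_run[OF B] by (intro sum_emeasure[symmetric]) auto
  also have "\<dots> = (\<Sum>k\<le>t. \<integral>\<^sup>+\<omega>. indicator (B k) \<omega> * ennreal (exp (stopped_log t \<omega>)) \<partial>run)"
  proof (rule sum.cong[OF refl])
    fix k assume "k \<in> {..t}"
    then have "indicator (B k) \<omega> * ennreal (likelihood (Suc k) \<omega>) =
        indicator (B k) \<omega> * ennreal (exp (stopped_log t \<omega>))" for \<omega>
      using stopped_log_stopped[of \<omega> k t] by (auto simp: B_def indicator_def)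
    then show "emeasure Q.run (B k) = (\<integral>\<^sup>+\<omega>. indicator (B k) \<omega> * ennreal (exp (stopped_log t \<omega>)) \<partial>run)"
      by (simp add: emeasure_shifted_run_info[OF B])
  qed
  also have "\<dots> = (\<integral>\<^sup>+\<omega>. (\<Sum>k\<le>t. indicator (B k) \<omega> * ennreal (exp (stopped_log t \<omega>))) \<partial>run)"
    by (rule nn_integral_sum[symmetric]) measurable
  also have "\<dots> = (\<integral>\<^sup>+\<omega>. indicator (\<Union>k\<in>{..t}. B k) \<omega> * ennreal (exp (stopped_log t \<omega>)) \<partial>run)"
    using disj by (simp add: indicator_UN_disjoint sum_distrib_right)
  finally show ?thesis
    unfolding un .
qed

text \<open>Optional stopping without martingale theory: the parts of the integral where the learner
  has stopped by \<open>t\<close> and where it is still running are the probabilities of these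
  events under the shifted law, which add up to 1.\<close>

lemma nn_integral_stopped_likelihood: "(\<integral>\<^sup>+\<omega>. exp (stopped_log t \<omega>) \<partial>run) = 1"
proof -
  \<comment> \<open>The vacuous conjunct makes \<open>?S\<close> an instance of
    \<open>emeasure_shifted_run_stopped\<close> with a constantly true predicate.\<close>
  let ?S = "{\<omega> \<in> \<Omega>. True \<and> \<tau> \<omega> \<le> enat t}" and ?R = "{\<omega> \<in> \<Omega>. enat t < \<tau> \<omega>}"
  have S: "{\<omega> \<in> \<Omega>. True \<and> \<tau> \<omega> \<le> enat k} \<in> sets (info D (enat k))" for k
    using stop_time_le_info by simp
  have "\<Omega> - ?S \<in> sets (info D (enat t))"
    using S[of t] sets.compl_sets[of ?S "info D (enat t)"] by (simp add: info.space_F)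
  also have "\<Omega> - ?S = ?R" by auto
  finally have R: "?R \<in> sets (info D (enat t))" .
  note [measurable] = sets_info_sets_run[OF S[of t]] sets_info_sets_run[OF R] measurable_stopped_log[of t]
  have "indicator ?R \<omega> * ennreal (likelihood (Suc t) \<omega>) = indicator ?R \<omega> * ennreal (exp (stopped_log t \<omega>))"
    for \<omega> using stopped_log_running[of t \<omega>] by (auto simp: indicator_def)
  then have QR: "emeasure Q.run ?R = (\<integral>\<^sup>+\<omega>. indicator ?R \<omega> * ennreal (exp (stopped_log t \<omega>)) \<partial>run)"
    by (simp add: emeasure_shifted_run_info[OF R])
  have "ennreal (exp (stopped_log t \<omega>)) = indicator ?S \<omega> * ennreal (exp (stopped_log t \<omega>)) +
      indicator ?R \<omega> * ennreal (exp (stopped_log t \<omega>))" if "\<omega> \<in> space run" for \<omega>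
    using that by (auto simp: indicator_def space_run)
  then have "(\<integral>\<^sup>+\<omega>. exp (stopped_log t \<omega>) \<partial>run) =
      (\<integral>\<^sup>+\<omega>. indicator ?S \<omega> * ennreal (exp (stopped_log t \<omega>)) +
        indicator ?R \<omega> * ennreal (exp (stopped_log t \<omega>)) \<partial>run)"
    by (rule nn_integral_cong)
  also have "\<dots> = emeasure Q.run ?S + emeasure Q.run ?R"
    unfolding QR emeasure_shifted_run_stopped[OF S] by (rule nn_integral_add) measurable
  also have "\<dots> = emeasure Q.run (?S \<union> ?R)"
    using Q.sets_info_sets_run[OF S] Q.sets_info_sets_run[OF R] by (intro plus_emeasure) auto
  also have "?S \<union> ?R = space Q.run"
    by (auto simp: Q.space_run)
  finally show ?thesis
    by (simp add: Q.emeasure_space_1)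
qed

section \<open>Divergence up to the stopping time\<close>

text \<open>Given the past, the stage \<open>h\<close> reward of a visiting episode has law
  \<open>\<nu> h s a\<close> whatever that past is, so it is independent of any event decided before
  the episode on which the triple is visited.\<close>

lemma nn_integral_history_event:
  fixes q :: "real \<Rightarrow> ennreal"
  assumes l: "0 < l" and A: "A \<in> sets (PiM {0..<l} obs)"
    and B: "B = {\<omega> \<in> \<Omega>. restrict \<omega> {0..<l} \<in> A}"
    and vis: "\<And>\<omega>. \<omega> \<in> B \<Longrightarrow> played alg l \<omega> \<in> visiting"
    and q[measurable]: "q \<in> borel_measurable borel"
  shows "(\<integral>\<^sup>+\<omega>. indicator B \<omega> * q (\<omega> l h) \<partial>run) = emeasure run B * (\<integral>\<^sup>+y. q y \<partial>\<nu> h s a)"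
proof -
  have B_run[measurable]: "B \<in> sets run"
    unfolding B by (rule sets_run_history[OF A])
  define f where "f x = indicator A (restrict x {0..<l}) * q (x l h)" for x :: history
  have "(\<lambda>x. restrict x {0..<l}) \<in> PiM {0..<Suc l} obs \<rightarrow>\<^sub>M PiM {0..<l} obs"
    by (intro measurable_restrict measurable_component_singleton) auto
  note [measurable] = measurable_compose[OF this borel_measurable_indicator[OF A]]
    measurable_compose[OF measurable_reward[of l "{0..<Suc l}"] q]
  have f: "f \<in> borel_measurable (PiM {0..<Suc l} obs)"
    unfolding f_def[abs_def] using l by measurable
  have "(\<integral>\<^sup>+\<omega>. indicator B \<omega> * q (\<omega> l h) \<partial>run) = (\<integral>\<^sup>+\<omega>. f (restrict \<omega> {0..<Suc l}) \<partial>run)"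
  proof (rule nn_integral_cong)
    fix \<omega> assume "\<omega> \<in> space run"
    moreover have "restrict (restrict \<omega> {0..<Suc l}) {0..<l} = restrict \<omega> {0..<l}"
      by (auto simp: fun_eq_iff)
    ultimately show "indicator B \<omega> * q (\<omega> l h) = f (restrict \<omega> {0..<Suc l})"
      by (simp add: f_def B space_run indicator_def)
  qed
  also have "\<dots> = (\<integral>\<^sup>+\<omega>. (\<integral>\<^sup>+y. f ((restrict \<omega> {0..<l})(l := y)) \<partial>Kn l \<omega>) \<partial>run)"
    by (rule nn_integral_run_Suc[OF f])
  also have "\<dots> = (\<integral>\<^sup>+\<omega>. indicator B \<omega> * (\<integral>\<^sup>+y. q y \<partial>\<nu> h s a) \<partial>run)"
  proof (rule nn_integral_cong)
    fix \<omega> assume \<omega>: "\<omega> \<in> space run"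
    have "restrict ((restrict \<omega> {0..<l})(l := y)) {0..<l} = restrict \<omega> {0..<l}" for y
      by (auto simp: fun_eq_iff)
    then have f_upd: "f ((restrict \<omega> {0..<l})(l := y)) = indicator B \<omega> * q (y h)" for y
      using \<omega> unfolding f_def by (simp add: B space_run indicator_def)
    show "(\<integral>\<^sup>+y. f ((restrict \<omega> {0..<l})(l := y)) \<partial>Kn l \<omega>) =
        indicator B \<omega> * (\<integral>\<^sup>+y. q y \<partial>\<nu> h s a)"
    proof (cases "\<omega> \<in> B")
      case True
      define \<pi> where "\<pi> = played alg l \<omega>"
      have \<pi>: "state_at D \<pi> h = s" "action_at D \<pi> h = a"
        using vis[OF True] by (auto simp: visiting_policies_def \<pi>_def)
      let ?M = "\<lambda>j. \<nu> j (state_at D \<pi> j) (action_at D \<pi> j)"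
      have "?M h = distr (PiM {1..horizon D} ?M) (?M h) (\<lambda>y. y h)"
        by (intro distr_PiM_component[symmetric] prob_space_reward stage)
      then have "(\<integral>\<^sup>+y. q y \<partial>\<nu> h s a) = (\<integral>\<^sup>+y. q y \<partial>distr (PiM {1..horizon D} ?M) (\<nu> h s a) (\<lambda>y. y h))"
        unfolding \<pi> by simp
      also have "\<dots> = (\<integral>\<^sup>+y. q (y h) \<partial>PiM {1..horizon D} ?M)"
      proof (rule nn_integral_distr)
        show "(\<lambda>y. y h) \<in> PiM {1..horizon D} ?M \<rightarrow>\<^sub>M \<nu> h s a"
          using measurable_component_singleton[OF stage, of ?M] unfolding \<pi> .
        show "q \<in> borel_measurable (distr (PiM {1..horizon D} ?M) (\<nu> h s a) (\<lambda>y. y h))"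
          unfolding measurable_distr_eq1 measurable_cong_sets[OF sets_reward[OF stage] refl] by (rule q)
      qed
      also have "PiM {1..horizon D} ?M = Kn l \<omega>"
        using l by (simp add: kernel_pos reward_product_def \<pi>_def)
      finally show ?thesis
        unfolding f_upd using True by simp
    qed (unfold f_upd, simp)
  qed
  also have "\<dots> = emeasure run B * (\<integral>\<^sup>+y. q y \<partial>\<nu> h s a)"
    by (simp add: nn_integral_multc)
  finally show ?thesis .
qed

text \<open>Signed version: the nonnegative one is applied to the norm for integrability, then to
  the positive and the negative part.\<close>

lemma has_bochner_integral_history_event:
  fixes g :: "real \<Rightarrow> real"
  assumes l: "0 < l" and A: "A \<in> sets (PiM {0..<l} obs)"
    and B: "B = {\<omega> \<in> \<Omega>. restrict \<omega> {0..<l} \<in> A}"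
    and vis: "\<And>\<omega>. \<omega> \<in> B \<Longrightarrow> played alg l \<omega> \<in> visiting"
    and g[measurable]: "g \<in> borel_measurable borel" and int: "integrable (\<nu> h s a) g"
  shows "has_bochner_integral run (\<lambda>\<omega>. indicator B \<omega> * g (\<omega> l h)) (prob B * (\<integral>y. g y \<partial>\<nu> h s a))"
proof -
  note E = nn_integral_history_event[OF l A B vis]
  have B_run[measurable]: "B \<in> sets run"
    unfolding B by (rule sets_run_history[OF A])
  have rew: "(\<lambda>\<omega>. \<omega> l h) \<in> borel_measurable run"
    using measurable_reward[of l UNIV] l unfolding measurable_cong_sets[OF sets_run refl] by simp
  have meas: "(\<lambda>\<omega>. indicator B \<omega> * g (\<omega> l h)) \<in> borel_measurable run"
    using measurable_compose[OF rew g] by measurable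
  have "(\<integral>\<^sup>+\<omega>. norm (indicator B \<omega> * g (\<omega> l h)) \<partial>run) =
      (\<integral>\<^sup>+\<omega>. indicator B \<omega> * ennreal (norm (g (\<omega> l h))) \<partial>run)"
    by (intro nn_integral_cong) (auto simp: indicator_def)
  also have "\<dots> = emeasure run B * (\<integral>\<^sup>+y. norm (g y) \<partial>\<nu> h s a)"
    by (rule E) measurable
  also have "\<dots> < \<infinity>"
    using int by (auto simp: integrable_iff_bounded ennreal_mult_less_top emeasure_eq_measure)
  finally have int_run: "integrable run (\<lambda>\<omega>. indicator B \<omega> * g (\<omega> l h))"
    using meas by (simp add: integrable_iff_bounded)
  have pos: "(\<integral>\<^sup>+\<omega>. ennreal (indicator B \<omega> * g (\<omega> l h)) \<partial>run) =
      emeasure run B * (\<integral>\<^sup>+y. ennreal (g y) \<partial>\<nu> h s a)"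
    by (subst E[symmetric]) (auto intro!: nn_integral_cong simp: indicator_def)
  have neg: "(\<integral>\<^sup>+\<omega>. ennreal (- (indicator B \<omega> * g (\<omega> l h))) \<partial>run) =
      emeasure run B * (\<integral>\<^sup>+y. ennreal (- g y) \<partial>\<nu> h s a)"
    by (subst E[symmetric]) (auto intro!: nn_integral_cong simp: indicator_def)
  have "(\<integral>\<omega>. indicator B \<omega> * g (\<omega> l h) \<partial>run) = prob B * (\<integral>y. g y \<partial>\<nu> h s a)"
    unfolding real_lebesgue_integral_def[OF int_run] real_lebesgue_integral_def[OF int] pos neg
    by (simp add: enn2real_mult measure_def right_diff_distrib)
  with int_run show ?thesis
    by (simp add: has_bochner_integral_iff)
qed

text \<open>The mean is minus the Kullback-Leibler divergence of the two Gaussians: the linear part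
  of \<open>log_ratio\<close> is centred at \<open>r\<close> and vanishes.\<close>

lemma log_ratio_moment:
  "integrable (\<nu> h s a) log_ratio" "(\<integral>y. log_ratio y \<partial>\<nu> h s a) = - (d\<^sup>2 / (2 * \<sigma>2))"
proof -
  interpret N: prob_space "\<nu> h s a"
    by (rule prob_space_reward[OF stage])
  have id: "integrable (\<nu> h s a) (\<lambda>y. y)"
    using pos_variance
    by (subst reward_law[OF stage])
       (auto simp: integrable_real_density integrable_normal_moment_nz_1)
  then show "integrable (\<nu> h s a) log_ratio"
    unfolding log_ratio_def[abs_def] by simp
  have "(\<integral>y. log_ratio y \<partial>\<nu> h s a) = d / \<sigma>2 * ((\<integral>y. y \<partial>\<nu> h s a) - r) - d\<^sup>2 / (2 * \<sigma>2)"
    unfolding log_ratio_def[abs_def] using id by (simp add: N.prob_space)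
  then show "(\<integral>y. log_ratio y \<partial>\<nu> h s a) = - (d\<^sup>2 / (2 * \<sigma>2))"
    by (simp add: mean_reward_def)
qed

definition visit_event :: "nat \<Rightarrow> history set" where
  "visit_event l = {\<omega> \<in> \<Omega>. enat l \<le> \<tau> \<omega> \<and> played alg l \<omega> \<in> visiting}"

lemma visit_event_history:
  assumes "0 < l"
  obtains A where "A \<in> sets (PiM {0..<l} obs)"
    "visit_event l = {\<omega> \<in> \<Omega>. restrict \<omega> {0..<l} \<in> A}"
proof -
  obtain A where A: "A \<in> sets (PiM {0..<l} obs)"
    "{\<omega> \<in> \<Omega>. enat l \<le> \<tau> \<omega>} = {\<omega> \<in> \<Omega>. restrict \<omega> {0..<l} \<in> A}"
    by (rule episode_history[OF assms])
  have "{x \<in> space (PiM {0..<l} obs). played alg l x \<in> visiting} \<in> sets (PiM {0..<l} obs)"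
    using measurable_visiting[OF assms] by (simp add: pred_def)
  then have "A \<inter> {x \<in> space (PiM {0..<l} obs). played alg l x \<in> visiting} \<in> sets (PiM {0..<l} obs)"
    using A(1) by auto
  moreover have "visit_event l = {\<omega> \<in> \<Omega>. restrict \<omega> {0..<l} \<in>
      A \<inter> {x \<in> space (PiM {0..<l} obs). played alg l x \<in> visiting}}"
  proof (rule set_eqI)
    fix \<omega> :: history
    have "\<omega> \<in> \<Omega> \<Longrightarrow> enat l \<le> \<tau> \<omega> \<longleftrightarrow> restrict \<omega> {0..<l} \<in> A"
      using A(2) by blast
    moreover have "\<omega> \<in> \<Omega> \<Longrightarrow> restrict \<omega> {0..<l} \<in> space (PiM {0..<l} obs)"
      by (auto simp: space_PiM)
    ultimately show "\<omega> \<in> visit_event l \<longleftrightarrow> \<omega> \<in> {\<omega> \<in> \<Omega>. restrict \<omega> {0..<l} \<in>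
        A \<inter> {x \<in> space (PiM {0..<l} obs). played alg l x \<in> visiting}}"
      by (simp only: visit_event_def mem_Collect_eq Int_iff played_restrict[OF order_refl]) blast
  qed
  ultimately show thesis
    by (rule that)
qed

lemma visit_event_sets:
  assumes "0 < l"
  shows "visit_event l \<in> sets run"
  by (rule visit_event_history[OF assms]) (simp only: sets_run_history)

text \<open>Wald's identity, truncated at \<open>t\<close>: a visit is decided before its reward is
  drawn, so each episode contributes the probability of its visit times the common mean of
  \<open>log_ratio\<close>.\<close>

lemma has_bochner_integral_stopped_log:
  "has_bochner_integral run (stopped_log t) (- (d\<^sup>2 / (2 * \<sigma>2)) * (\<Sum>l=1..t. prob (visit_event l)))"
proof -
  have "has_bochner_integral run (\<lambda>\<omega>. indicator (visit_event l) \<omega> * log_ratio (\<omega> l h))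
      (prob (visit_event l) * - (d\<^sup>2 / (2 * \<sigma>2)))" if "l \<in> {1..t}" for l
  proof -
    have l: "0 < l" using that by simp
    obtain A where A: "A \<in> sets (PiM {0..<l} obs)"
      "visit_event l = {\<omega> \<in> \<Omega>. restrict \<omega> {0..<l} \<in> A}"
      by (rule visit_event_history[OF l])
    show ?thesis
      using has_bochner_integral_history_event[OF l A _ measurable_log_ratio log_ratio_moment(1)]
      by (simp add: log_ratio_moment(2) visit_event_def)
  qed
  then have "has_bochner_integral run (\<lambda>\<omega>. \<Sum>l=1..t. indicator (visit_event l) \<omega> * log_ratio (\<omega> l h))
      (\<Sum>l=1..t. prob (visit_event l) * - (d\<^sup>2 / (2 * \<sigma>2)))"
    by (rule has_bochner_integral_sum)
  moreover have "(\<Sum>l=1..t. prob (visit_event l) * - (d\<^sup>2 / (2 * \<sigma>2))) =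
      - (d\<^sup>2 / (2 * \<sigma>2)) * (\<Sum>l=1..t. prob (visit_event l))"
    by (simp add: sum_distrib_left mult.commute sum_negf)
  moreover have "(\<Sum>l=1..t. indicator (visit_event l) \<omega> * log_ratio (\<omega> l h)) = stopped_log t \<omega>"
    if "\<omega> \<in> space run" for \<omega>
    unfolding stopped_log_def
  proof (rule sum.cong[OF refl])
    fix l assume "l \<in> {1..t}"
    then show "indicator (visit_event l) \<omega> * log_ratio (\<omega> l h) =
        (if enat l \<le> \<tau> \<omega> then log_step l \<omega> else 0)"
      using that by (auto simp: log_step_def visit_event_def space_run)
  qed
  ultimately show ?thesis
    by (simp cong: has_bochner_integral_cong)
qed

text \<open>
  Integrate \<open>ln M \<le> c M - 1 - ln c\<close> for the stopped likelihood ratio \<open>M\<close>, with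
  \<open>c = 1 / (2 \<delta>)\<close> on the event and \<open>c = 1 / 2\<close> off it; this avoids conditional expectations.
\<close>

lemma divergence_bound:
  assumes E: "E \<subseteq> policies D" and \<delta>: "0 < \<delta>" "\<delta> \<le> 1"
    and QE: "measure Q.run {\<omega> \<in> \<Omega>. recommend alg \<omega> \<in> E \<and> \<tau> \<omega> \<le> enat t} \<le> \<delta>"
  shows "prob {\<omega> \<in> \<Omega>. recommend alg \<omega> \<in> E \<and> \<tau> \<omega> \<le> enat t} * ln (1 / \<delta>) - ln 2
    \<le> d\<^sup>2 / (2 * \<sigma>2) * (\<Sum>l=1..t. prob (visit_event l))"
proof -
  let ?B = "{\<omega> \<in> \<Omega>. recommend alg \<omega> \<in> E \<and> \<tau> \<omega> \<le> enat t}"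
  let ?M = "\<lambda>\<omega>. exp (stopped_log t \<omega>)"
  let ?L = "d\<^sup>2 / (2 * \<sigma>2) * (\<Sum>l=1..t. prob (visit_event l))"
  have [measurable]: "?B \<in> sets run" "stopped_log t \<in> borel_measurable run"
    using sets_info_sets_run[OF recommend_info[OF E]] measurable_stopped_log by auto
  have M: "has_bochner_integral run ?M 1"
    by (rule has_bochner_integral_nn_integral) (auto simp: nn_integral_stopped_likelihood)
  have BM: "has_bochner_integral run (\<lambda>\<omega>. indicator ?B \<omega> * ?M \<omega>) (measure Q.run ?B)"
  proof (rule has_bochner_integral_nn_integral)
    have "(\<integral>\<^sup>+\<omega>. ennreal (indicator ?B \<omega> * ?M \<omega>) \<partial>run) = (\<integral>\<^sup>+\<omega>. indicator ?B \<omega> * ennreal (?M \<omega>) \<partial>run)"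
      by (intro nn_integral_cong) (auto simp: indicator_def)
    also have "\<dots> = emeasure Q.run ?B"
      by (rule emeasure_shifted_run_stopped[OF recommend_info[OF E], symmetric])
    finally show "(\<integral>\<^sup>+\<omega>. ennreal (indicator ?B \<omega> * ?M \<omega>) \<partial>run) = ennreal (measure Q.run ?B)"
      by (simp add: Q.emeasure_eq_measure)
  qed auto
  have B: "has_bochner_integral run (indicator ?B) (prob ?B)"
    by (rule has_bochner_integral_real_indicator) (auto simp: emeasure_eq_measure)
  have one: "has_bochner_integral run (\<lambda>_. 1 - ln 2 :: real) (1 - ln 2)"
    by (simp add: has_bochner_integral_iff prob_space)
  \<comment> \<open>Both choices of \<open>c\<close> in one formula: \<open>1 / 2\<close> times the
    ratio everywhere plus the excess on \<open>?B\<close>, while \<open>- ln c\<close> gives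
    \<open>ln 2\<close> everywhere and an additional \<open>ln \<delta>\<close> on
    \<open>?B\<close>.\<close>
  have upper: "has_bochner_integral run
     (\<lambda>\<omega>. (1 / (2 * \<delta>) - 1 / 2) * (indicator ?B \<omega> * ?M \<omega>) + 1 / 2 * ?M \<omega> + ln \<delta> * indicator ?B \<omega> - (1 - ln 2))
     ((1 / (2 * \<delta>) - 1 / 2) * measure Q.run ?B + 1 / 2 * 1 + ln \<delta> * prob ?B - (1 - ln 2))"
    by (rule has_bochner_integral_diff[OF has_bochner_integral_add[OF has_bochner_integral_add] one])
       (rule has_bochner_integral_mult_right, rule BM M B)+
  have "stopped_log t \<omega> \<le> (1 / (2 * \<delta>) - 1 / 2) * (indicator ?B \<omega> * ?M \<omega>) + 1 / 2 * ?M \<omega>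
      + ln \<delta> * indicator ?B \<omega> - (1 - ln 2)" for \<omega>
  proof (cases "\<omega> \<in> ?B")
    case True
    have "ln (1 / (2 * \<delta>) * ?M \<omega>) \<le> 1 / (2 * \<delta>) * ?M \<omega> - 1"
      using \<delta> by (intro ln_le_minus_one) simp
    also have "ln (1 / (2 * \<delta>) * ?M \<omega>) = stopped_log t \<omega> - ln 2 - ln \<delta>"
      using \<delta> by (simp add: ln_mult ln_div)
    finally show ?thesis
      using True by (simp add: left_diff_distrib)
  next
    case False
    have "ln (1 / 2 * ?M \<omega>) \<le> 1 / 2 * ?M \<omega> - 1"
      by (intro ln_le_minus_one) simp
    also have "ln (1 / 2 * ?M \<omega>) = stopped_log t \<omega> - ln 2"
      by (simp add: ln_mult ln_div)
    finally show ?thesis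
      using False by simp
  qed
  then have "- ?L \<le> (1 / (2 * \<delta>) - 1 / 2) * measure Q.run ?B + 1 / 2 * 1 + ln \<delta> * prob ?B - (1 - ln 2)"
    using integral_mono[OF integrable.intros[OF has_bochner_integral_stopped_log[of t]]
        integrable.intros[OF upper]]
    unfolding has_bochner_integral_integral_eq[OF has_bochner_integral_stopped_log[of t]]
      has_bochner_integral_integral_eq[OF upper]
    by (simp only: mult_minus_left)
  \<comment> \<open>The coefficient is nonnegative because \<open>\<delta> \<le> 1\<close>, so the
    bound under the shifted law can be inserted. The ratio terms then amount to at most 1/2 + 1/2
    and are absorbed by the constant -1.\<close>
  moreover have "(1 / (2 * \<delta>) - 1 / 2) * measure Q.run ?B \<le> (1 / (2 * \<delta>) - 1 / 2) * \<delta>"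
    using \<delta> QE by (intro mult_left_mono) (auto simp: field_simps)
  moreover have "(1 / (2 * \<delta>) - 1 / 2) * \<delta> \<le> 1 / 2"
    using \<delta> by (simp add: field_simps)
  ultimately show ?thesis
    using \<delta> by (simp add: ln_div algebra_simps)
qed

end

section \<open>The PAC guarantee as a bound on error probabilities\<close>

context interaction
begin

abbreviation "recommends E \<equiv> {\<omega> \<in> \<Omega>. recommend alg \<omega> \<in> E}"

lemma recommends_sets [measurable]:
  assumes "E \<subseteq> policies D"
  shows "recommends E \<in> sets run"
proof -
  have r: "(\<lambda>\<omega>. restrict \<omega> UNIV) \<in> \<Omega> \<rightarrow> \<Omega>"
    by (simp add: restrict_def)
  \<comment> \<open>At time \<open>\<infinity>\<close> the constraint on stopping is vacuous, and
    the information is that of all coordinates.\<close>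
  have "{\<omega> \<in> \<Omega>. recommend alg \<omega> \<in> E \<and> \<tau> \<omega> \<le> \<infinity>} \<in> sets (info D \<infinity>)"
    by (rule recommend_info[OF assms])
  also have "sets (info D \<infinity>) = {(\<lambda>\<omega>. restrict \<omega> UNIV) -` A \<inter> \<Omega> | A. A \<in> sets (PiM UNIV obs)}"
    using sets_vimage_algebra2[OF r] by (simp add: info_def)
  finally have "recommends E \<in> \<dots>"
    by simp
  then show ?thesis
    by (auto simp: sets_run)
qed

lemma recommend_policy: "\<omega> \<in> \<Omega> \<Longrightarrow> recommend alg \<omega> \<in> policies D"
  using algorithm measurable_space[of "recommend alg" "info.pre_sigma \<tau>" "count_space (policies D)" \<omega>]
  by (simp add: valid_algorithm_def info.space_pre_sigma)

lemma prob_recommends_compl: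
  assumes "E \<subseteq> policies D"
  shows "prob (recommends (policies D - E)) = 1 - prob (recommends E)"
proof -
  have "recommends (policies D - E) = space run - recommends E"
    using recommend_policy by (auto simp: space_run)
  then show ?thesis
    using prob_compl[OF recommends_sets[OF assms]] by simp
qed

lemma policy_return_le_optimal: "\<pi> \<in> policies D \<Longrightarrow> policy_return D \<nu> \<pi> \<le> optimal_return D \<nu>"
  unfolding optimal_return_def by (intro Max_ge) (auto simp: finite_policies)

text \<open>Serves both models: with the original rewards it shows that some set of recommendations
  is likely (by complement), with the shifted ones that the same set is unlikely.\<close>

lemma prob_recommends_bad:
  assumes pac: "pac_on (gaussian_mdps \<sigma>2) \<epsilon> \<delta> D alg" and E: "E \<subseteq> policies D"
    and bad: "\<And>\<pi>. \<pi> \<in> E \<Longrightarrow> policy_return D \<nu> \<pi> < optimal_return D \<nu> - \<epsilon>"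
  shows "prob (recommends E) \<le> \<delta>"
proof -
  have "1 - \<delta> \<le> prob {\<omega> \<in> space run. policy_return D \<nu> (recommend alg \<omega>) \<ge> optimal_return D \<nu> - \<epsilon>}"
    using pac gaussian by (auto simp: pac_on_def)
  also have "\<dots> \<le> prob (recommends (policies D - E))"
    using bad recommend_policy
    by (intro finite_measure_mono recommends_sets) (force simp: space_run)+
  finally show ?thesis
    unfolding prob_recommends_compl[OF E] by simp
qed

lemma finite_stop_time:
  assumes "pac_on (gaussian_mdps \<sigma>2) \<epsilon> \<delta> D alg"
  shows "AE \<omega> in run. \<tau> \<omega> < \<infinity>"
  using assms gaussian by (auto simp: pac_on_def)

end

section \<open>From the divergence bound to expected visits\<close>

context shifted_interaction
begin

text \<open>Truncation at \<open>t\<close> can only lose visits. Almost sure stopping keeps the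
  default value of \<open>the_enat\<close> out of the integral.\<close>

lemma sum_visit_event_le_expected_visits:
  assumes "AE \<omega> in run. \<tau> \<omega> < \<infinity>"
  shows "ennreal (\<Sum>l=1..t. prob (visit_event l)) \<le> expected_visits D \<nu> alg h s a"
proof -
  note [measurable] = visit_event_sets
  have "ennreal (\<Sum>l=1..t. prob (visit_event l)) = (\<Sum>l=1..t. emeasure run (visit_event l))"
    by (simp add: emeasure_eq_measure sum_ennreal)
  also have "\<dots> = (\<Sum>l=1..t. \<integral>\<^sup>+\<omega>. indicator (visit_event l) \<omega> \<partial>run)"
    by (intro sum.cong refl) simp
  also have "\<dots> = (\<integral>\<^sup>+\<omega>. (\<Sum>l=1..t. indicator (visit_event l) \<omega>) \<partial>run)"
    by (rule nn_integral_sum[symmetric]) simp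
  also have "\<dots> \<le> expected_visits D \<nu> alg h s a"
    unfolding expected_visits_def
  proof (rule nn_integral_mono_AE)
    show "AE \<omega> in run. (\<Sum>l=1..t. indicator (visit_event l) \<omega>)
        \<le> (of_nat (visits D alg h s a (the_enat (\<tau> \<omega>)) \<omega>) :: ennreal)"
      using assms
    proof eventually_elim
      fix \<omega> assume "\<tau> \<omega> < \<infinity>"
      then obtain k where k: "\<tau> \<omega> = enat k"
        by (cases "\<tau> \<omega>") auto
      let ?v = "\<lambda>l. if played alg l \<omega> \<in> visiting then 1 else 0 :: nat"
      have "(\<Sum>l=1..t. indicator (visit_event l) \<omega> :: nat) \<le> (\<Sum>l=1..t. if l \<in> {..k} then ?v l else 0)"
        by (intro sum_mono) (auto simp: visit_event_def k indicator_def)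
      also have "\<dots> = sum ?v ({1..t} \<inter> {..k})"
        by (rule sum.inter_restrict[symmetric]) simp
      also have "\<dots> \<le> sum ?v {1..k}"
        by (intro sum_mono2) auto
      also have "\<dots> = visits D alg h s a k \<omega>"
        by (simp add: visits_def visiting_policies_def)
      finally have "of_nat (\<Sum>l=1..t. indicator (visit_event l) \<omega>) \<le>
          (of_nat (visits D alg h s a k \<omega>) :: ennreal)"
        by (rule of_nat_mono)
      moreover have "of_nat (indicator A x) = (indicator A x :: ennreal)" for A and x :: history
        by (simp add: indicator_def)
      ultimately show "(\<Sum>l=1..t. indicator (visit_event l) \<omega>)
          \<le> (of_nat (visits D alg h s a (the_enat (\<tau> \<omega>)) \<omega>) :: ennreal)"
        by (simp add: k)
    qed
  qed
  finally show ?thesis .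
qed

lemma expected_visits_ge:
  assumes fin: "AE \<omega> in run. \<tau> \<omega> < \<infinity>"
    and E: "E \<subseteq> policies D" and \<delta>: "0 < \<delta>" "\<delta> \<le> 1" and "d \<noteq> 0"
    and PE: "1 / 2 \<le> prob (recommends E)" and QE: "measure Q.run (recommends E) \<le> \<delta>"
  shows "ennreal (\<sigma>2 * ln (1 / (4 * \<delta>)) / d\<^sup>2) \<le> expected_visits D \<nu> alg h s a"
proof -
  define B where "B t = {\<omega> \<in> \<Omega>. recommend alg \<omega> \<in> E \<and> \<tau> \<omega> \<le> enat t}" for t
  have B[measurable]: "B t \<in> sets run" for t
    unfolding B_def by (rule sets_info_sets_run[OF recommend_info[OF E]])
  note [measurable] = recommends_sets[OF E]
  have c: "0 \<le> 2 * \<sigma>2 / d\<^sup>2"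
    using pos_variance by simp
  have "ennreal (2 * \<sigma>2 / d\<^sup>2 * (prob (B t) * ln (1 / \<delta>) - ln 2)) \<le> expected_visits D \<nu> alg h s a" for t
  proof -
    have "measure Q.run (B t) \<le> measure Q.run (recommends E)"
      using Q.recommends_sets[OF E] by (intro Q.finite_measure_mono) (auto simp: B_def)
    with QE have "measure Q.run (B t) \<le> \<delta>" by simp
    then have "prob (B t) * ln (1 / \<delta>) - ln 2 \<le> d\<^sup>2 / (2 * \<sigma>2) * (\<Sum>l=1..t. prob (visit_event l))"
      using divergence_bound[OF E \<delta>] by (simp add: B_def)
    from mult_left_mono[OF this c]
    have "2 * \<sigma>2 / d\<^sup>2 * (prob (B t) * ln (1 / \<delta>) - ln 2) \<le> (\<Sum>l=1..t. prob (visit_event l))"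
      using pos_variance \<open>d \<noteq> 0\<close> by simp
    then show ?thesis
      using sum_visit_event_le_expected_visits[OF fin, of t] by (meson ennreal_leI order_trans)
  qed
  moreover have "(\<lambda>t. ennreal (2 * \<sigma>2 / d\<^sup>2 * (prob (B t) * ln (1 / \<delta>) - ln 2))) \<longlonglongrightarrow>
      ennreal (2 * \<sigma>2 / d\<^sup>2 * (prob (recommends E) * ln (1 / \<delta>) - ln 2))"
  proof -
    \<comment> \<open>The truncated events exhaust \<open>recommends E\<close> up to the null set
      where the learner never stops; the truncation level can now tend to infinity.\<close>
    have "prob (\<Union>t. B t) = prob (recommends E)"
    proof (rule finite_measure_eq_AE)
      have "\<omega> \<in> (\<Union>t. B t) \<longleftrightarrow> \<omega> \<in> recommends E" if "\<tau> \<omega> < \<infinity>" for \<omega>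
        using that by (cases "\<tau> \<omega>") (auto simp: B_def)
      then show "AE \<omega> in run. \<omega> \<in> (\<Union>t. B t) \<longleftrightarrow> \<omega> \<in> recommends E"
        by (rule eventually_mono[OF fin])
    qed auto
    moreover have "incseq B"
      by (auto simp: incseq_def B_def intro: order_trans)
    ultimately have "(\<lambda>t. prob (B t)) \<longlonglongrightarrow> prob (recommends E)"
      using finite_Lim_measure_incseq[of B] by (simp add: image_subset_iff)
    then show ?thesis
      by (intro tendsto_intros)
  qed
  ultimately have "ennreal (2 * \<sigma>2 / d\<^sup>2 * (prob (recommends E) * ln (1 / \<delta>) - ln 2)) \<le>
      expected_visits D \<nu> alg h s a"
    by (intro LIMSEQ_le_const2) auto
  \<comment> \<open>The left side is the right side with the probability lowered to 1/2; this uses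
    \<open>ln (1 / \<delta>) \<ge> 0\<close>, hence \<open>\<delta> \<le> 1\<close>.\<close>
  moreover have "\<sigma>2 * ln (1 / (4 * \<delta>)) / d\<^sup>2 \<le> 2 * \<sigma>2 / d\<^sup>2 * (prob (recommends E) * ln (1 / \<delta>) - ln 2)"
  proof -
    have "ln (4 :: real) = 2 * ln 2"
      using ln_realpow[of 2 2] by simp
    then have "\<sigma>2 * ln (1 / (4 * \<delta>)) / d\<^sup>2 = 2 * \<sigma>2 / d\<^sup>2 * (1 / 2 * ln (1 / \<delta>) - ln 2)"
      using \<delta> \<open>d \<noteq> 0\<close> by (simp add: ln_div ln_mult field_simps)
    also have "\<dots> \<le> 2 * \<sigma>2 / d\<^sup>2 * (prob (recommends E) * ln (1 / \<delta>) - ln 2)"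
      using PE \<delta> by (intro mult_left_mono[OF _ c] diff_mono mult_right_mono) auto
    finally show ?thesis .
  qed
  ultimately show ?thesis
    by (meson ennreal_leI order_trans)
qed

end

context interaction
begin

text \<open>Hides the shifted model: \<open>better\<close> is a comparison of original returns with
  the shift added by hand, and says that one policy \<open>\<pi>'\<close> beats all of
  \<open>E\<close> by more than \<epsilon> after the shift. Choosing \<open>d\<close>,
  \<open>E\<close> and \<open>\<pi>'\<close> is then elementary.\<close>

lemma expected_visits_ge_shift:
  assumes pac: "pac_on (gaussian_mdps \<sigma>2) \<epsilon> \<delta> D alg" and stage: "h \<in> {1..horizon D}"
    and E: "E \<subseteq> policies D" and \<delta>: "0 < \<delta>" "\<delta> \<le> 1" and "d \<noteq> 0"
    and PE: "1 / 2 \<le> prob (recommends E)"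
    and better: "\<pi>' \<in> policies D"
      "\<And>\<pi>. \<pi> \<in> E \<Longrightarrow> policy_return D \<nu> \<pi> + (if \<pi> \<in> visiting_policies D h s a then d else 0) + \<epsilon> <
        policy_return D \<nu> \<pi>' + (if \<pi>' \<in> visiting_policies D h s a then d else 0)"
  shows "ennreal (\<sigma>2 * ln (1 / (4 * \<delta>)) / d\<^sup>2) \<le> expected_visits D \<nu> alg h s a"
proof -
  interpret shifted_interaction D \<nu> alg \<sigma>2 h s a d
    by unfold_locales (rule stage)
  have "measure Q.run (recommends E) \<le> \<delta>"
  proof (rule Q.prob_recommends_bad[OF pac E])
    fix \<pi> assume "\<pi> \<in> E"
    then have "policy_return D \<nu>' \<pi> + \<epsilon> < policy_return D \<nu>' \<pi>'"
      using better(2) by (simp only: policy_return_shift_mean[OF pos_variance stage])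
    also have "\<dots> \<le> optimal_return D \<nu>'"
      by (rule Q.policy_return_le_optimal[OF better(1)])
    finally show "policy_return D \<nu>' \<pi> < optimal_return D \<nu>' - \<epsilon>"
      by simp
  qed
  then show ?thesis
    using finite_stop_time[OF pac] E \<delta> \<open>d \<noteq> 0\<close> PE by (intro expected_visits_ge)
qed

end

section \<open>Choice of the shift\<close>

lemma state_at_cong:
  assumes "\<And>j. j < h \<Longrightarrow> \<pi> j = \<pi>' j"
  shows "state_at D \<pi> h = state_at D \<pi>' h"
  using assms by (induction h) auto

lemma policies_through_eq: "policies_through D h s a = policies D \<inter> visiting_policies D h s a"
  by (auto simp: policies_through_def visiting_policies_def)

text \<open>Keeps the \<open>Max\<close> in \<open>return_gap\<close> away from the empty
  set.\<close>

lemma policies_through_nonempty: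
  assumes h: "h \<in> {1..horizon D}" and s: "s \<in> reachable D h" and a: "a \<in> avail D h s"
  shows "policies_through D h s a \<noteq> {}"
proof -
  obtain \<pi> where \<pi>: "\<pi> \<in> policies D" "state_at D \<pi> h = s"
    using s by (auto simp: reachable_def)
  \<comment> \<open>Changing the decision at stage \<open>h\<close> in state \<open>s\<close> does
    not affect how stage \<open>h\<close> is reached.\<close>
  define \<pi>' where "\<pi>' = \<pi>(h := (\<pi> h)(s := a))"
  have "\<pi>' \<in> policies D"
    using \<pi>(1) h a unfolding policies_def \<pi>'_def by (auto simp: PiE_iff extensional_def)
  moreover have "state_at D \<pi>' h = s"
    using state_at_cong[of h \<pi>' \<pi> D] \<pi>(2) by (simp add: \<pi>'_def)
  ultimately have "\<pi>' \<in> policies_through D h s a"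
    by (simp add: policies_through_def action_at_def \<pi>'_def)
  then show ?thesis by blast
qed

context interaction
begin

lemma return_gap_props:
  assumes "h \<in> {1..horizon D}" "s \<in> reachable D h" "a \<in> avail D h s"
  shows "\<exists>\<pi>\<in>policies_through D h s a. policy_return D \<nu> \<pi> = optimal_return D \<nu> - return_gap D \<nu> h s a"
    and "\<And>\<pi>. \<pi> \<in> policies_through D h s a \<Longrightarrow>
      policy_return D \<nu> \<pi> \<le> optimal_return D \<nu> - return_gap D \<nu> h s a"
proof -
  have fin: "finite (policy_return D \<nu> ` policies_through D h s a)"
    by (simp add: policies_through_eq finite_policies)
  have ne: "policy_return D \<nu> ` policies_through D h s a \<noteq> {}"
    using policies_through_nonempty[OF assms] by simp
  show "\<exists>\<pi>\<in>policies_through D h s a. policy_return D \<nu> \<pi> = optimal_return D \<nu> - return_gap D \<nu> h s a"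
    using Max_in[OF fin ne] by (auto simp: return_gap_def)
  show "policy_return D \<nu> \<pi> \<le> optimal_return D \<nu> - return_gap D \<nu> h s a"
    if "\<pi> \<in> policies_through D h s a" for \<pi>
    using Max_ge[OF fin] that by (simp add: return_gap_def)
qed

lemma optimal_return_attained: "\<exists>\<pi>\<in>policies D. policy_return D \<nu> \<pi> = optimal_return D \<nu>"
proof -
  have "optimal_return D \<nu> \<in> policy_return D \<nu> ` policies D"
    unfolding optimal_return_def using policies_nonempty by (intro Max_in) (auto simp: finite_policies)
  then show ?thesis by force
qed

text \<open>A deterministic policy meets exactly one pair at stage \<open>h\<close>. If all
  near-optimal policies visit the triple, no other pair qualifies; the gap assumption provides one
  that does visit it.\<close>

lemma near_optimal_pairs_singleton:
  assumes h: "h \<in> {1..horizon D}" and s: "s \<in> reachable D h" and a: "a \<in> avail D h s"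
    and gap: "return_gap D \<nu> h s a \<le> \<epsilon>"
    and only: "\<And>\<pi>. \<pi> \<in> policies D - visiting_policies D h s a \<Longrightarrow>
      policy_return D \<nu> \<pi> < optimal_return D \<nu> - \<epsilon>"
  shows "near_optimal_pairs D \<nu> \<epsilon> h = {(s, a)}"
proof (rule set_eqI, clarify)
  fix s' a'
  obtain \<pi>1 where \<pi>1: "\<pi>1 \<in> policies_through D h s a"
    "policy_return D \<nu> \<pi>1 = optimal_return D \<nu> - return_gap D \<nu> h s a"
    using return_gap_props(1)[OF h s a] by blast
  show "(s', a') \<in> near_optimal_pairs D \<nu> \<epsilon> h \<longleftrightarrow> (s', a') \<in> {(s, a)}"
  proof
    assume "(s', a') \<in> near_optimal_pairs D \<nu> \<epsilon> h"
    then obtain \<pi> where \<pi>: "\<pi> \<in> policies_through D h s' a'" "\<pi> \<in> near_optimal_policies D \<nu> \<epsilon>"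
      by (auto simp: near_optimal_pairs_def)
    then have "\<pi> \<in> visiting_policies D h s a"
      using only[of \<pi>] by (force simp: near_optimal_policies_def)
    with \<pi>(1) show "(s', a') \<in> {(s, a)}"
      by (auto simp: policies_through_def visiting_policies_def)
  next
    assume "(s', a') \<in> {(s, a)}"
    then show "(s', a') \<in> near_optimal_pairs D \<nu> \<epsilon> h"
      using \<pi>1 gap s a
      by (auto simp: near_optimal_pairs_def near_optimal_policies_def policies_through_eq)
  qed
qed

text \<open>Here \<open>x\<close> is any real majorant of the three terms of the maximum. One
  \<open>\<eta>\<close> makes the comparison of returns strict, the other allows a pair that is only
  close to the infimum defining the minimal gap.\<close>

lemma expected_visits_ge_slack:
  assumes pac: "pac_on (gaussian_mdps \<sigma>2) \<epsilon> \<delta> D alg" and \<epsilon>: "0 < \<epsilon>" and \<delta>: "0 < \<delta>" "\<delta> \<le> 1 / 4"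
    and h: "h \<in> {1..horizon D}" and s: "s \<in> reachable D h" and a: "a \<in> avail D h s"
    and x: "\<epsilon> \<le> x" "return_gap D \<nu> h s a \<le> x" "min_return_gap D \<nu> \<epsilon> h \<le> ereal x"
    and \<eta>: "0 < \<eta>"
  shows "ennreal (\<sigma>2 * ln (1 / (4 * \<delta>)) / (2 * x + 2 * \<eta>)\<^sup>2) \<le> expected_visits D \<nu> alg h s a"
proof -
  let ?R = "policy_return D \<nu>" and ?V = "optimal_return D \<nu>" and ?gap = "return_gap D \<nu> h s a"
  let ?vis = "visiting_policies D h s a"
  define T where "T = policies_through D h s a"
  have T: "T \<subseteq> policies D" "\<And>\<pi>. \<pi> \<in> policies D \<Longrightarrow> \<pi> \<in> ?vis \<longleftrightarrow> \<pi> \<in> T"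
    by (auto simp: T_def policies_through_eq)
  obtain \<pi>1 where \<pi>1: "\<pi>1 \<in> T" "?R \<pi>1 = ?V - ?gap"
    using return_gap_props(1)[OF h s a] by (auto simp: T_def)
  have gap_le: "?R \<pi> \<le> ?V - ?gap" if "\<pi> \<in> T" for \<pi>
    using return_gap_props(2)[OF h s a] that by (simp add: T_def)
  note opt_le = policy_return_le_optimal
  have \<delta>1: "\<delta> \<le> 1" using \<delta> by simp
  have gap_nonneg: "0 \<le> ?gap"
    using \<pi>1 opt_le[of \<pi>1] T by auto
  have L: "0 \<le> \<sigma>2 * ln (1 / (4 * \<delta>))"
    using \<delta> pos_variance by simp
  \<comment> \<open>A smaller shift gives a larger bound, so only
    \<open>\<bar>d\<bar> \<le> 2 * x + 2 * \<eta>\<close> has to be checked. This needs the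
    logarithm to be nonnegative, that is \<open>\<delta> \<le> 1 / 4\<close>.\<close>
  have bound: ?thesis
    if "d \<noteq> 0" "\<bar>d\<bar> \<le> 2 * x + 2 * \<eta>" "E \<subseteq> policies D" "1 / 2 \<le> prob (recommends E)" "\<pi>' \<in> policies D"
      "\<And>\<pi>. \<pi> \<in> E \<Longrightarrow> ?R \<pi> + (if \<pi> \<in> T then d else 0) + \<epsilon> < ?R \<pi>' + (if \<pi>' \<in> T then d else 0)"
    for d E \<pi>'
  proof -
    have "ennreal (\<sigma>2 * ln (1 / (4 * \<delta>)) / d\<^sup>2) \<le> expected_visits D \<nu> alg h s a"
    proof (rule expected_visits_ge_shift[OF pac h that(3) \<delta>(1) \<delta>1 that(1,4,5)])
      fix \<pi> assume "\<pi> \<in> E"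
      then show "?R \<pi> + (if \<pi> \<in> ?vis then d else 0) + \<epsilon> < ?R \<pi>' + (if \<pi>' \<in> ?vis then d else 0)"
        using that(3) by (simp only: T(2)[OF subsetD[OF that(3)]] T(2)[OF that(5)] that(6))
    qed
    moreover have "d\<^sup>2 \<le> (2 * x + 2 * \<eta>)\<^sup>2"
      using power_mono[OF that(2), of 2] by simp
    then have "\<sigma>2 * ln (1 / (4 * \<delta>)) / (2 * x + 2 * \<eta>)\<^sup>2 \<le> \<sigma>2 * ln (1 / (4 * \<delta>)) / d\<^sup>2"
    proof (rule divide_left_mono[OF _ L])
      have "0 < (2 * x + 2 * \<eta>)\<^sup>2"
        using x(1) \<epsilon> \<eta> by (intro zero_less_power) simp
      then show "0 < (2 * x + 2 * \<eta>)\<^sup>2 * d\<^sup>2"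
        using \<open>d \<noteq> 0\<close> by simp
    qed
    ultimately show ?thesis
      by (meson ennreal_leI order_trans)
  qed
  have compl: "policies D - T \<subseteq> policies D" by auto
  consider (raise) "\<epsilon> < ?gap"
    | (other) \<pi>2 where "?gap \<le> \<epsilon>" "\<pi>2 \<in> policies D - T" "?V - \<epsilon> \<le> ?R \<pi>2"
    | (only) "?gap \<le> \<epsilon>" "\<And>\<pi>. \<pi> \<in> policies D - T \<Longrightarrow> ?R \<pi> < ?V - \<epsilon>"
    by (meson not_less)
  then show ?thesis
  proof cases
    case raise
    \<comment> \<open>After the shift only policies through \<open>(h, s, a)\<close> are near-optimal.\<close>
    have "prob (recommends T) \<le> \<delta>"
      using raise gap_le by (intro prob_recommends_bad[OF pac T(1)]) force
    then have "1 / 2 \<le> prob (recommends (policies D - T))"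
      unfolding prob_recommends_compl[OF T(1)] using \<delta> by simp
    \<comment> \<open>\<open>\<pi>1\<close> starts \<open>?gap\<close> below the optimum and is
      lifted to \<open>?V + \<epsilon> + \<eta>\<close>, while policies off the triple stay at most
      \<open>?V\<close>.\<close>
    then show ?thesis
      using raise \<epsilon> \<eta> x \<pi>1 T(1) gap_nonneg
      by (intro bound[of "?gap + \<epsilon> + \<eta>" "policies D - T" \<pi>1]) (auto dest!: opt_le)
  next
    case other
    \<comment> \<open>Shift against the more likely recommendation: down if it visits \<open>(h, s, a)\<close>, up if not.\<close>
    show ?thesis
    proof (cases "1 / 2 \<le> prob (recommends T)")
      case True
      \<comment> \<open>All of \<open>T\<close> drops to at most
        \<open>?V - 2 * \<epsilon> - \<eta>\<close>, and \<open>\<pi>2\<close> stays at least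
        \<open>?V - \<epsilon>\<close>.\<close>
      then show ?thesis
        using other \<epsilon> \<eta> x T(1) gap_nonneg
        by (intro bound[of "- (2 * \<epsilon> + \<eta>)" T \<pi>2]) (auto dest!: opt_le subsetD)
    next
      case False
      then have "1 / 2 \<le> prob (recommends (policies D - T))"
        unfolding prob_recommends_compl[OF T(1)] by simp
      \<comment> \<open>Since \<open>?gap \<le> \<epsilon>\<close>, the policy \<open>\<pi>1\<close>
        is lifted to at least \<open>?V + \<epsilon> + \<eta>\<close>.\<close>
      then show ?thesis
        using other \<epsilon> \<eta> x \<pi>1 T(1) gap_nonneg
        by (intro bound[of "2 * \<epsilon> + \<eta>" "policies D - T" \<pi>1]) (auto dest!: opt_le)
    qed
  next
    case only
    \<comment> \<open>Lower the triple until a policy at the minimal positive gap beats it by more than \<open>\<epsilon>\<close>.\<close>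
    have "near_optimal_pairs D \<nu> \<epsilon> h = {(s, a)}"
      using only T by (intro near_optimal_pairs_singleton[OF h s a]) auto
    \<comment> \<open>A real upper bound \<open>x\<close> excludes the infimum over the empty set,
      so a competing pair of positive gap exists.\<close>
    then have "(INF (s, a)\<in>{(s, a). s \<in> reachable D h \<and> a \<in> avail D h s \<and> 0 < return_gap D \<nu> h s a}.
        ereal (return_gap D \<nu> h s a)) < ereal (x + \<eta>)"
      using x(3) \<eta> by (simp add: min_return_gap_def order.strict_trans1)
    then obtain s' a' where sa: "s' \<in> reachable D h" "a' \<in> avail D h s'"
      "0 < return_gap D \<nu> h s' a'" "return_gap D \<nu> h s' a' < x + \<eta>"
      by (auto simp: INF_less_iff)
    define g where "g = return_gap D \<nu> h s' a'"
    obtain \<pi>3 where \<pi>3: "\<pi>3 \<in> policies_through D h s' a'" "?R \<pi>3 = ?V - g"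
      using return_gap_props(1)[OF h sa(1,2)] by (auto simp: g_def)
    obtain \<pi>s where \<pi>s: "\<pi>s \<in> policies D" "?R \<pi>s = ?V"
      using optimal_return_attained by auto
    \<comment> \<open>An optimal policy must visit the triple, whose gap is therefore 0. A pair of
      positive gap is then a different one, and a policy through it at stage \<open>h\<close> avoids
      the triple.\<close>
    then have "\<pi>s \<in> T"
      using only(2)[of \<pi>s] \<epsilon> by force
    then have "?gap = 0"
      using gap_le[of \<pi>s] \<pi>s gap_nonneg by simp
    then have "(s', a') \<noteq> (s, a)"
      using sa(3) by auto
    then have \<pi>3': "\<pi>3 \<in> policies D - T"
      using \<pi>3(1) by (auto simp: T_def policies_through_def)
    have "prob (recommends (policies D - T)) \<le> \<delta>"
      using only by (intro prob_recommends_bad[OF pac compl]) auto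
    then have "1 / 2 \<le> prob (recommends T)"
      unfolding prob_recommends_compl[OF T(1)] using \<delta> by simp
    \<comment> \<open>All of \<open>T\<close> drops to at most
      \<open>?V - g - \<epsilon> - \<eta>\<close>, and \<open>\<pi>3\<close> stays at
      \<open>?V - g\<close>. As \<open>g < x + \<eta>\<close>, the size of this shift can exceed
      \<open>x + \<epsilon> + \<eta>\<close>, which is what the second \<open>\<eta>\<close> is
      for.\<close>
    then show ?thesis
      using \<epsilon> \<eta> x T(1) \<pi>3 \<pi>3' sa(3,4) unfolding g_def[symmetric]
      by (intro bound[of "- (g + \<epsilon> + \<eta>)" T \<pi>3]) (auto dest!: opt_le subsetD)
  qed
qed

lemma visit_bound_le_expected_visits:
  assumes pac: "pac_on (gaussian_mdps \<sigma>2) \<epsilon> \<delta> D alg" and \<epsilon>: "0 < \<epsilon>" and \<delta>: "0 < \<delta>"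
    and h: "h \<in> {1..horizon D}" and s: "s \<in> reachable D h" and a: "a \<in> avail D h s"
  shows "ennreal (visit_bound D \<nu> \<sigma>2 \<epsilon> \<delta> h s a) \<le> expected_visits D \<nu> alg h s a"
proof -
  define m where "m = Max {ereal (return_gap D \<nu> h s a), min_return_gap D \<nu> \<epsilon> h, ereal \<epsilon>}"
  define c where "c = \<sigma>2 * ln (1 / (4 * \<delta>))"
  have m: "ereal (return_gap D \<nu> h s a) \<le> m" "min_return_gap D \<nu> \<epsilon> h \<le> m" "ereal \<epsilon> \<le> m"
    unfolding m_def by (intro Max_ge; simp)+
  have vb: "visit_bound D \<nu> \<sigma>2 \<epsilon> \<delta> h s a = real_of_ereal (ereal c / (4 * m\<^sup>2))"
    by (simp add: visit_bound_def m_def c_def)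
  show ?thesis
  proof (cases m)
    case PInf
    \<comment> \<open>The maximum is infinite only through an infimum over no pairs; division by
      \<open>\<infinity>\<close> then yields the trivial bound.\<close>
    then have "visit_bound D \<nu> \<sigma>2 \<epsilon> \<delta> h s a = 0"
      by (simp add: vb power2_eq_square)
    then show ?thesis by simp
  next
    case MInf
    then show ?thesis using m by simp
  next
    case (real x)
    then have x: "\<epsilon> \<le> x" "return_gap D \<nu> h s a \<le> x" "min_return_gap D \<nu> \<epsilon> h \<le> ereal x"
      using m by auto
    have vb_eq: "visit_bound D \<nu> \<sigma>2 \<epsilon> \<delta> h s a = c / (2 * x)\<^sup>2"
      using x \<epsilon> by (simp add: vb real power2_eq_square)
    show ?thesis
    proof (cases "\<delta> \<le> 1 / 4")
      case True
      \<comment> \<open>The limit \<open>\<eta> \<rightarrow> 0\<close> is harmless because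
        \<open>x \<ge> \<epsilon> > 0\<close> keeps the denominator away from 0.\<close>
      have "ennreal (c / (2 * x + 2 * \<eta>)\<^sup>2) \<le> expected_visits D \<nu> alg h s a" if "0 < \<eta>" for \<eta>
        unfolding c_def by (rule expected_visits_ge_slack[OF pac \<epsilon> \<delta> True h s a x that])
      then have "\<forall>\<^sub>F \<eta> in at_right 0. ennreal (c / (2 * x + 2 * \<eta>)\<^sup>2) \<le> expected_visits D \<nu> alg h s a"
        by (simp add: eventually_at_filter)
      moreover have "((\<lambda>\<eta>. ennreal (c / (2 * x + 2 * \<eta>)\<^sup>2)) \<longlongrightarrow> ennreal (c / (2 * x + 2 * 0)\<^sup>2)) (at_right 0)"
        using x \<epsilon> by (intro tendsto_intros) auto
      ultimately show ?thesis
        unfolding vb_eq by (intro tendsto_upperbound[where F="at_right (0::real)"]) auto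
    next
      case False
      then have "c \<le> 0"
        using pos_variance by (simp add: c_def mult_nonneg_nonpos)
      then have "visit_bound D \<nu> \<sigma>2 \<epsilon> \<delta> h s a \<le> 0"
        unfolding vb_eq by (intro divide_nonpos_nonneg) auto
      then show ?thesis by (simp add: ennreal_neg)
    qed
  qed
qed

end

section \<open>Expected visits as a flow\<close>

lemma policy_avail: "\<pi> \<in> policies D \<Longrightarrow> h \<in> {1..horizon D} \<Longrightarrow> \<pi> h s \<in> avail D h s"
  by (auto simp: policies_def PiE_iff)

text \<open>Each episode occupies exactly one pair at stage \<open>h\<close>, so summing visits over
  \<open>A\<close> counts episodes.\<close>

lemma sum_visits:
  assumes "finite A"
  shows "(\<Sum>(s, a)\<in>A. visits D alg h s a t \<omega>) =
    (\<Sum>l=1..t. if (state_at D (played alg l \<omega>) h, action_at D (played alg l \<omega>) h) \<in> A then 1 else 0)"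
proof -
  have "(\<Sum>(s, a)\<in>A. visits D alg h s a t \<omega>) = (\<Sum>p\<in>A. \<Sum>l=1..t.
      if p = (state_at D (played alg l \<omega>) h, action_at D (played alg l \<omega>) h) then 1 else 0)"
    unfolding visits_def by (intro sum.cong refl) (auto intro!: sum.cong)
  also have "\<dots> = (\<Sum>l=1..t. \<Sum>p\<in>A.
      if p = (state_at D (played alg l \<omega>) h, action_at D (played alg l \<omega>) h) then 1 else 0)"
    by (rule sum.swap)
  also have "\<dots> = (\<Sum>l=1..t.
      if (state_at D (played alg l \<omega>) h, action_at D (played alg l \<omega>) h) \<in> A then 1 else 0)"
    using assms by (intro sum.cong refl) (simp add: sum.delta)
  finally show ?thesis .
qed

lemma sum_avail_visits:
  fixes D :: "('s::finite, 'a::finite) environment"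
  assumes "\<And>l. l \<in> {1..t} \<Longrightarrow> played alg l \<omega> \<in> policies D" "h \<in> {1..horizon D}"
  shows "(\<Sum>a\<in>avail D h s. visits D alg h s a t \<omega>) =
    (\<Sum>l=1..t. if state_at D (played alg l \<omega>) h = s then 1 else 0)"
proof -
  have "(\<Sum>a\<in>avail D h s. visits D alg h s a t \<omega>) = (\<Sum>(s, a)\<in>{s} \<times> avail D h s. visits D alg h s a t \<omega>)"
    by (simp flip: sum.cartesian_product)
  also have "\<dots> = (\<Sum>l=1..t. if state_at D (played alg l \<omega>) h = s then 1 else 0)"
    unfolding sum_visits[OF finite]
  proof (intro sum.cong refl)
    fix l assume "l \<in> {1..t}"
    then have "action_at D (played alg l \<omega>) h \<in> avail D h (state_at D (played alg l \<omega>) h)"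
      unfolding action_at_def by (intro policy_avail assms)
    then show "(if (state_at D (played alg l \<omega>) h, action_at D (played alg l \<omega>) h) \<in> {s} \<times> avail D h s
        then 1 else 0) = (if state_at D (played alg l \<omega>) h = s then 1 else 0)"
      by auto
  qed
  finally show ?thesis .
qed

text \<open>Conservation already holds on every run: both sides count the episodes that are in
  \<open>s\<close> at stage \<open>h\<close>, on the left because deterministic transitions make the
  preceding pair decide this. From stage 2 on, the state really comes from a transition and not from
  the initial state.\<close>

lemma visits_flow:
  fixes D :: "('s::finite, 'a::finite) environment"
  assumes played: "\<And>l. l \<in> {1..t} \<Longrightarrow> played alg l \<omega> \<in> policies D" and h: "h \<in> {2..horizon D}"
  shows "(\<Sum>(s', a') | s' \<in> reachable D (h - 1) \<and> a' \<in> avail D (h - 1) s' \<and>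
      trans_fun D (h - 1) s' a' = s. visits D alg (h - 1) s' a' t \<omega>) =
    (\<Sum>a\<in>avail D h s. visits D alg h s a t \<omega>)"
proof -
  obtain j where j: "h = Suc j" "j \<in> {1..horizon D}"
    using h by (cases h) auto
  have h': "h \<in> {1..horizon D}"
    using h by auto
  have "(\<Sum>a\<in>avail D h s. visits D alg h s a t \<omega>) =
      (\<Sum>l=1..t. if state_at D (played alg l \<omega>) h = s then 1 else 0)"
    by (rule sum_avail_visits[OF _ h']) (rule played)
  then show ?thesis
    unfolding sum_visits[OF finite]
  proof (elim ssubst)
    show "(\<Sum>l=1..t. if (state_at D (played alg l \<omega>) (h - 1), action_at D (played alg l \<omega>) (h - 1)) \<in>
        {(s', a'). s' \<in> reachable D (h - 1) \<and> a' \<in> avail D (h - 1) s' \<and> trans_fun D (h - 1) s' a' = s}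
        then 1 else 0) = (\<Sum>l=1..t. if state_at D (played alg l \<omega>) h = s then 1 else 0)"
    proof (intro sum.cong refl)
      fix l assume "l \<in> {1..t}"
      then have "played alg l \<omega> \<in> policies D" by (rule played)
      then show "(if (state_at D (played alg l \<omega>) (h - 1), action_at D (played alg l \<omega>) (h - 1)) \<in>
          {(s', a'). s' \<in> reachable D (h - 1) \<and> a' \<in> avail D (h - 1) s' \<and> trans_fun D (h - 1) s' a' = s}
          then 1 else 0) = (if state_at D (played alg l \<omega>) h = s then 1 else 0)"
        using j policy_avail[of "played alg l \<omega>" D j] by (auto simp: action_at_def reachable_def)
    qed
  qed
qed

context interaction
begin

lemma measurable_visits:
  "(\<lambda>\<omega>. of_nat (visits D alg h s a (the_enat (\<tau> \<omega>)) \<omega>) :: ennreal) \<in> borel_measurable run"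
proof (rule measurable_compose_countable[where g="\<lambda>\<omega>. the_enat (\<tau> \<omega>)"])
  show "(\<lambda>\<omega>. the_enat (\<tau> \<omega>)) \<in> run \<rightarrow>\<^sub>M count_space UNIV"
    by (rule measurable_compose[OF measurable_stop_time]) simp
  show "(\<lambda>\<omega>. of_nat (visits D alg h s a t \<omega>) :: ennreal) \<in> borel_measurable run" for t
    unfolding visits_def of_nat_sum
  proof (rule borel_measurable_sum)
    fix l assume "l \<in> {1..t}"
    then have "played alg l \<in> run \<rightarrow>\<^sub>M count_space (policies D)"
      using measurable_played[of l UNIV] by (simp add: measurable_cong_sets[OF sets_run refl])
    then show "(\<lambda>\<omega>. of_nat (if state_at D (played alg l \<omega>) h = s \<and>
        action_at D (played alg l \<omega>) h = a then 1 else 0) :: ennreal) \<in> borel_measurable run"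
      by (rule measurable_compose) simp
  qed
qed

lemma played_policies: "\<omega> \<in> space run \<Longrightarrow> l \<in> {1..t} \<Longrightarrow> played alg l \<omega> \<in> policies D"
  using played_in_policies[of l \<omega>] by (simp add: space_run)

lemma expected_visits_flow:
  assumes h: "h \<in> {2..horizon D}"
  shows "(\<Sum>(s', a') | s' \<in> reachable D (h - 1) \<and> a' \<in> avail D (h - 1) s' \<and>
      trans_fun D (h - 1) s' a' = s. expected_visits D \<nu> alg (h - 1) s' a') =
    (\<Sum>a\<in>avail D h s. expected_visits D \<nu> alg h s a)" (is "sum _ ?A = _")
proof -
  have "(\<Sum>(s', a')\<in>?A. expected_visits D \<nu> alg (h - 1) s' a') =
      (\<integral>\<^sup>+\<omega>. (\<Sum>(s', a')\<in>?A. of_nat (visits D alg (h - 1) s' a' (the_enat (\<tau> \<omega>)) \<omega>)) \<partial>run)"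
    unfolding expected_visits_def split_beta
    by (rule nn_integral_sum[symmetric]) (rule measurable_visits)
  also have "\<dots> = (\<integral>\<^sup>+\<omega>. (\<Sum>a\<in>avail D h s. of_nat (visits D alg h s a (the_enat (\<tau> \<omega>)) \<omega>)) \<partial>run)"
  proof (rule nn_integral_cong)
    fix \<omega> assume \<omega>: "\<omega> \<in> space run"
    have "(\<Sum>(s', a')\<in>?A. visits D alg (h - 1) s' a' (the_enat (\<tau> \<omega>)) \<omega>) =
        (\<Sum>a\<in>avail D h s. visits D alg h s a (the_enat (\<tau> \<omega>)) \<omega>)"
      by (rule visits_flow[OF _ h]) (rule played_policies[OF \<omega>])
    then have "of_nat (\<Sum>(s', a')\<in>?A. visits D alg (h - 1) s' a' (the_enat (\<tau> \<omega>)) \<omega>) =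
        (of_nat (\<Sum>a\<in>avail D h s. visits D alg h s a (the_enat (\<tau> \<omega>)) \<omega>) :: ennreal)"
      by simp
    then show "(\<Sum>(s', a')\<in>?A. of_nat (visits D alg (h - 1) s' a' (the_enat (\<tau> \<omega>)) \<omega>)) =
        (\<Sum>a\<in>avail D h s. of_nat (visits D alg h s a (the_enat (\<tau> \<omega>)) \<omega>) :: ennreal)"
      by (simp add: split_beta)
  qed
  also have "\<dots> = (\<Sum>a\<in>avail D h s. expected_visits D \<nu> alg h s a)"
    unfolding expected_visits_def by (rule nn_integral_sum) (rule measurable_visits)
  finally show ?thesis .
qed

lemma expected_stop_time_eq:
  assumes "AE \<omega> in run. \<tau> \<omega> < \<infinity>"
  shows "expected_stop_time D \<nu> alg = (\<integral>\<^sup>+\<omega>. of_nat (the_enat (\<tau> \<omega>)) \<partial>run)"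
  unfolding expected_stop_time_def
proof (rule nn_integral_cong_AE)
  have "ennreal_of_enat e = of_nat (the_enat e)" if "e < \<infinity>" for e
    using that by (cases e) auto
  then show "AE \<omega> in run. ennreal_of_enat (\<tau> \<omega>) = of_nat (the_enat (\<tau> \<omega>))"
    by (intro eventually_mono[OF assms])
qed

lemma expected_visits_first_stage:
  assumes "AE \<omega> in run. \<tau> \<omega> < \<infinity>"
  shows "(\<Sum>a\<in>avail D 1 (init_state D). expected_visits D \<nu> alg 1 (init_state D) a) =
    expected_stop_time D \<nu> alg"
proof -
  have "(\<Sum>a\<in>avail D 1 (init_state D). expected_visits D \<nu> alg 1 (init_state D) a) =
      (\<integral>\<^sup>+\<omega>. (\<Sum>a\<in>avail D 1 (init_state D).
        of_nat (visits D alg 1 (init_state D) a (the_enat (\<tau> \<omega>)) \<omega>)) \<partial>run)"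
    unfolding expected_visits_def by (rule nn_integral_sum[symmetric]) (rule measurable_visits)
  also have "\<dots> = (\<integral>\<^sup>+\<omega>. of_nat (the_enat (\<tau> \<omega>)) \<partial>run)"
  proof (rule nn_integral_cong)
    fix \<omega> assume \<omega>: "\<omega> \<in> space run"
    have "(\<Sum>a\<in>avail D 1 (init_state D). visits D alg 1 (init_state D) a (the_enat (\<tau> \<omega>)) \<omega>) =
        (\<Sum>l=1..the_enat (\<tau> \<omega>). if state_at D (played alg l \<omega>) 1 = init_state D then 1 else 0)"
      by (rule sum_avail_visits) (use played_policies[OF \<omega>] horizon_pos in auto)
    then have "(\<Sum>a\<in>avail D 1 (init_state D). visits D alg 1 (init_state D) a (the_enat (\<tau> \<omega>)) \<omega>) =
        the_enat (\<tau> \<omega>)"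
      by simp
    then show "(\<Sum>a\<in>avail D 1 (init_state D). of_nat (visits D alg 1 (init_state D) a (the_enat (\<tau> \<omega>)) \<omega>)) =
        (of_nat (the_enat (\<tau> \<omega>)) :: ennreal)"
      by (simp flip: of_nat_sum)
  qed
  finally show ?thesis
    by (simp add: expected_stop_time_eq[OF assms])
qed

lemma expected_visits_le_stop_time:
  assumes "AE \<omega> in run. \<tau> \<omega> < \<infinity>"
  shows "expected_visits D \<nu> alg h s a \<le> expected_stop_time D \<nu> alg"
  unfolding expected_stop_time_eq[OF assms] expected_visits_def
proof (intro nn_integral_mono of_nat_mono)
  fix \<omega>
  have "visits D alg h s a t \<omega> \<le> (\<Sum>l=1..t. 1)" for t
    unfolding visits_def by (intro sum_mono) auto
  then show "visits D alg h s a (the_enat (\<tau> \<omega>)) \<omega> \<le> the_enat (\<tau> \<omega>)"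
    by simp
qed

lemma min_flow_le_expected_stop_time:
  assumes fin: "AE \<omega> in run. \<tau> \<omega> < \<infinity>"
    and c: "\<And>h s a. h \<in> {1..horizon D} \<Longrightarrow> s \<in> reachable D h \<Longrightarrow> a \<in> avail D h s \<Longrightarrow>
      ennreal (c h s a) \<le> expected_visits D \<nu> alg h s a"
  shows "min_flow D c \<le> expected_stop_time D \<nu> alg"
\<comment> \<open>Flows are real-valued, so the expected visits can serve as one only when they are
  finite; they are dominated by the expected stopping time, and if that is infinite the claim is
  trivial.\<close>
proof (cases "expected_stop_time D \<nu> alg = \<top>")
  case False
  define \<eta> where "\<eta> h s a = enn2real (expected_visits D \<nu> alg h s a)" for h s a
  have EV: "expected_visits D \<nu> alg h s a < \<top>" for h s a
    using expected_visits_le_stop_time[OF fin, of h s a] False by (auto simp: less_top[symmetric] top_unique)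
  then have ennreal_\<eta>: "ennreal (\<eta> h s a) = expected_visits D \<nu> alg h s a" for h s a
    by (simp add: \<eta>_def)
  have nonneg: "0 \<le> \<eta> h s a" for h s a
    by (simp add: \<eta>_def)
  have "is_flow D \<eta>"
    unfolding is_flow_def
  proof (intro conjI ballI)
    fix h s assume h: "h \<in> {2..horizon D}"
    let ?A = "{(s', a'). s' \<in> reachable D (h - 1) \<and> a' \<in> avail D (h - 1) s' \<and> trans_fun D (h - 1) s' a' = s}"
    have "ennreal (\<Sum>(s', a')\<in>?A. \<eta> (h - 1) s' a') = ennreal (\<Sum>a\<in>avail D h s. \<eta> h s a)"
      using expected_visits_flow[OF h, of s] by (simp add: split_beta nonneg ennreal_\<eta> flip: sum_ennreal)
    then show "(\<Sum>(s', a')\<in>?A. \<eta> (h - 1) s' a') = (\<Sum>a\<in>avail D h s. \<eta> h s a)"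
      by (simp add: split_beta nonneg sum_nonneg)
  qed (rule nonneg)
  \<comment> \<open>Although \<open>ennreal\<close> truncates at 0, nothing is lost for a negative
    \<open>c\<close> (which occurs for \<open>\<delta> > 1 / 4\<close>), since \<open>\<eta>\<close>
    is nonnegative.\<close>
  moreover have "c h s a \<le> \<eta> h s a"
    if "h \<in> {1..horizon D}" "s \<in> reachable D h" "a \<in> avail D h s" for h s a
    using c[OF that] by (simp add: ennreal_\<eta>[symmetric] nonneg ennreal_le_iff)
  ultimately have "min_flow D c \<le> ennreal (\<Sum>a\<in>avail D 1 (init_state D). \<eta> 1 (init_state D) a)"
    unfolding min_flow_def by (intro INF_lower) auto
  also have "\<dots> = expected_stop_time D \<nu> alg"
    using expected_visits_first_stage[OF fin] by (simp add: nonneg ennreal_\<eta> flip: sum_ennreal)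
  finally show ?thesis .
qed simp

end

theorem theorem1:
  fixes D :: "('s::finite, 'a::finite) environment"
    and \<nu> :: "('s, 'a) rewards"
    and alg :: "('s, 'a) algorithm"
    and \<sigma>2 \<epsilon> \<delta> :: real
  assumes "\<sigma>2 > 0" and "\<epsilon> > 0" and "0 < \<delta>" and "\<delta> < 1"
    and "(D, \<nu>) \<in> gaussian_mdps \<sigma>2"
    and "valid_algorithm D alg"
    and "pac_on (gaussian_mdps \<sigma>2) \<epsilon> \<delta> D alg"
  shows "(\<forall>h\<in>{1..horizon D}. \<forall>s\<in>reachable D h. \<forall>a\<in>avail D h s.
            expected_visits D \<nu> alg h s a \<ge> ennreal (visit_bound D \<nu> \<sigma>2 \<epsilon> \<delta> h s a))
       \<and> expected_stop_time D \<nu> alg \<ge> min_flow D (visit_bound D \<nu> \<sigma>2 \<epsilon> \<delta>)"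
proof -
  interpret interaction D \<nu> alg \<sigma>2
    by (rule interaction.intro) fact+
  note bound = visit_bound_le_expected_visits[OF assms(7,2,3)]
  show ?thesis
    using bound min_flow_le_expected_stop_time[OF finite_stop_time[OF assms(7)] bound] by blast
qed

end
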